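(* Suppose $X$ is a metrizable space and $h:X\to X$ is a homeomorphism such that $\overline{\{h^{n}(x) : n\in\mathbb{Z}\}}$ is compact for every $x\in X$. Then the following are equivalent: (1) $h$ is a compactly almost periodic homeomorphism. (2) For some metric $d$ on $X$, $\{h^{n} : n\in\mathbb{Z}\}$ is an equicontinuous family of maps. (3) For some metric $d^{*}$ on $X$, $h:(X,d^{*})\to (X,d^{*})$ is an isometry. (4) For each metric $d$ on $X$, $\{h^{n} : n\in\mathbb{Z}\}$ is an equicontinuous family of maps. (5) $\overline{\{h^{n} : n\in\mathbb{Z}\}}$ is a compact subspace of $C(X,X)$. (6) There exists a metric $d^{*}$ on $X$ such that $\overline{\{h^{n} : n\in\mathbb{Z}\}}\subset C(X,X)$ is a compact abelian topological group (under composition) of isometries of $(X,d^{*})$.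
   Context: All metrics on a metrizable space $X$ are required to induce the given topology of $X$. $C(X,X)$ is the space of continuous maps $X\to X$ with the compact-open topology, and the closures in (5) and (6) are taken in $C(X,X)$. A homeomorphism $h$ of a metric space $(X,d)$ is almost periodic if for each $\varepsilon>0$ there is an integer $N\ge 0$ such that for every $M\in\mathbb{Z}$ there is an integer $i$ with $M\le i\le M+N$ and $d(h^{i}(x),x)<\varepsilon$ for all $x\in X$. A homeomorphism $h$ of a metrizable space $X$ is compactly almost periodic if (i) $\overline{\bigcup_{n\in\mathbb{Z}}h^{n}(B)}$ is compact for each compact $B\subset X$, and (ii) for each compact $A\subset X$ with $h(A)=A$, the restriction $h|_{A}:A\to A$ is an almost periodic homeomorphism of $A$ (with respect to a metric on $A$ inducing its topology; since $A$ is compact the choice of metric is immaterial). A family $\mathcal{F}$ of maps from $(A,d_A)$ to $(Y,d_Y)$ is equicontinuous if for each $a\in A$ and $\varepsilon>0$ there is $\delta>0$ such that for all $f\in\mathcal{F}$, $d_A(a,x)<\delta$ implies $d_Y(f(a),f(x))<\varepsilon$. An isometry of $(X,d)$ is a homeomorphism $f:X\to X$ with $d(x,y)=d(f(x),f(y))$ for all $x,y\in X$. *)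

theory Defs
  imports "HOL-Analysis.Analysis" "HOL-Algebra.Group"
begin

definition metric_for :: "'a topology \<Rightarrow> ('a \<Rightarrow> 'a \<Rightarrow> real) \<Rightarrow> bool" where
  "metric_for X d \<longleftrightarrow>
     Metric_space (topspace X) d \<and> Metric_space.mtopology (topspace X) d = X"

text \<open>
  The integer iterates of a bijection \<open>h\<close> of the carrier \<open>S\<close>. Self-maps of a carrier are
  represented by functions that are \<^const>\<open>undefined\<close> outside it, so that two maps are equal
  as soon as they agree on \<open>S\<close>.
\<close>

definition iterate :: "'a set \<Rightarrow> ('a \<Rightarrow> 'a) \<Rightarrow> int \<Rightarrow> 'a \<Rightarrow> 'a" where
  "iterate S h n =
     restrict (if n \<ge> 0 then h ^^ nat n else inv_into S h ^^ nat (- n)) S"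

definition continuous_self_maps :: "'a topology \<Rightarrow> ('a \<Rightarrow> 'a) set" where
  "continuous_self_maps X = {f \<in> extensional (topspace X). continuous_map X X f}"

definition compact_open_topology :: "'a topology \<Rightarrow> ('a \<Rightarrow> 'a) topology" where
  "compact_open_topology X = topology_generated_by
     {{f \<in> continuous_self_maps X. f ` K \<subseteq> U} | K U. compactin X K \<and> openin X U}"

lemma topspace_compact_open_topology [simp]:
  "topspace (compact_open_topology X) = continuous_self_maps X"
proof -
  have "continuous_self_maps X
      \<in> {{f \<in> continuous_self_maps X. f ` K \<subseteq> U} | K U. compactin X K \<and> openin X U}"
    by (intro CollectI exI[of _ "{}"]) auto
  then show ?thesis
    unfolding compact_open_topology_def topology_generated_by_topspace by blast
qed

definition almost_periodic :: "'a set \<Rightarrow> ('a \<Rightarrow> 'a \<Rightarrow> real) \<Rightarrow> ('a \<Rightarrow> 'a) \<Rightarrow> bool" where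
  "almost_periodic S d h \<longleftrightarrow>
     homeomorphic_map (Metric_space.mtopology S d) (Metric_space.mtopology S d) h \<and>
     (\<forall>\<epsilon>>0. \<exists>N::int. N \<ge> 0 \<and>
        (\<forall>M::int. \<exists>i. M \<le> i \<and> i \<le> M + N \<and> (\<forall>x\<in>S. d (iterate S h i x) x < \<epsilon>)))"

text \<open>
  Since \<open>A\<close> below is compact, any two metrics inducing its topology are uniformly equivalent,
  so it does not matter for which of them almost periodicity is required.
\<close>

definition compactly_almost_periodic :: "'a topology \<Rightarrow> ('a \<Rightarrow> 'a) \<Rightarrow> bool" where
  "compactly_almost_periodic X h \<longleftrightarrow>
     homeomorphic_map X X h \<and>
     (\<forall>B. compactin X B \<longrightarrow>
        compactin X (X closure_of (\<Union>n::int. iterate (topspace X) h n ` B))) \<and>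
     (\<forall>A. compactin X A \<and> h ` A = A \<longrightarrow>
        (\<exists>d. metric_for (subtopology X A) d \<and> almost_periodic A d (restrict h A)))"

definition equicontinuous ::
    "'a set \<Rightarrow> ('a \<Rightarrow> 'a \<Rightarrow> real) \<Rightarrow> 'b set \<Rightarrow> ('b \<Rightarrow> 'b \<Rightarrow> real) \<Rightarrow> ('a \<Rightarrow> 'b) set \<Rightarrow> bool" where
  "equicontinuous A dA Y dY F \<longleftrightarrow>
     F \<subseteq> A \<rightarrow> Y \<and>
     (\<forall>a\<in>A. \<forall>\<epsilon>>0. \<exists>\<delta>>0. \<forall>f\<in>F. \<forall>x\<in>A. dA a x < \<delta> \<longrightarrow> dY (f a) (f x) < \<epsilon>)"

definition isometry :: "'a set \<Rightarrow> ('a \<Rightarrow> 'a \<Rightarrow> real) \<Rightarrow> ('a \<Rightarrow> 'a) \<Rightarrow> bool" where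
  "isometry S d f \<longleftrightarrow>
     homeomorphic_map (Metric_space.mtopology S d) (Metric_space.mtopology S d) f \<and>
     (\<forall>x\<in>S. \<forall>y\<in>S. d x y = d (f x) (f y))"

definition composition_monoid :: "'a set \<Rightarrow> ('a \<Rightarrow> 'a) set \<Rightarrow> ('a \<Rightarrow> 'a) monoid" where
  "composition_monoid S F =
     \<lparr>carrier = F, monoid.mult = (\<lambda>f g. compose S f g), one = restrict id S\<rparr>"

definition topological_group :: "('a, 'b) monoid_scheme \<Rightarrow> 'a topology \<Rightarrow> bool" where
  "topological_group G T \<longleftrightarrow>
     group G \<and> topspace T = carrier G \<and>
     continuous_map (prod_topology T T) T (\<lambda>(x, y). x \<otimes>\<^bsub>G\<^esub> y) \<and>
     continuous_map T T (\<lambda>x. inv\<^bsub>G\<^esub> x)"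

definition all_equivalent :: "bool list \<Rightarrow> bool" where
  "all_equivalent Ps \<longleftrightarrow> (\<forall>P\<in>set Ps. \<forall>Q\<in>set Ps. P \<longleftrightarrow> Q)"

end

theory Submission
  imports Defs
begin

text \<open>
  An invariant metric is the hub of the equivalence. Equicontinuity of the powers for one metric
  produces such a metric; from it follow compact almost periodicity and the compact group of
  isometries; and each of these leads back to equicontinuity for every metric.

  From equicontinuity to an invariant metric: truncate the metric at \<open>1\<close> and take the supremum over
  all its translates by powers of \<open>h\<close>. Equicontinuity of the powers keeps the topology unchanged
  (\<open>invariant_metric_if_equicontinuous\<close>).

  From an invariant metric to compact almost periodicity: the isometries \<open>h\<^sup>n\<close> carry convergence
  along the orbit of a point over to nearby points, so the union of all images of a compact set under
  the powers is relatively compact; and on a compact invariant set the powers are totally bounded in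
  the uniform distance, so that one of finitely many differences of exponents brings any power near
  the identity (\<open>compactly_almost_periodic_if_isometry\<close>).

  From an invariant metric to the group: on the set of distance-preserving self-maps the
  compact-open topology is the topology of pointwise convergence
  (\<open>compact_open_eq_pointwise_on_isometries\<close>). Therefore the closure of the powers is a closed part
  of a product of compact orbit closures, hence compact, and composition is continuous on it. The
  group laws pass to the closure by continuity, except for the existence of inverses, which follows
  from compactness (\<open>closure_has_inverses\<close>, \<open>isometric_closure_topological_group\<close>).

  Back to equicontinuity: it may be tested on compact sets, because a failure shows along a convergent
  sequence (\<open>equicontinuous_if_on_compacts\<close>). A compact set lies in a compact invariant one, where
  almost periodicity reduces all powers to finitely many up to a uniform error
  (\<open>equicontinuous_iterates_if_compactly_almost_periodic\<close>). For a family of maps that is compact in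
  the compact-open topology, the necessity half of Ascoli's theorem applies
  (\<open>equicontinuous_if_compact_open_compact\<close>).
\<close>

section \<open>Integer iterates of a bijection\<close>

lemma iterate_0: "iterate S h 0 = restrict id S"
  by (simp add: iterate_def)

lemma iterate_extensional: "iterate S h n \<in> extensional S"
  by (simp add: iterate_def)

lemma iterate_step:
  assumes h: "bij_betw h S S" and x: "x \<in> S"
  shows "iterate S h n x \<in> S" "iterate S h (n + 1) x = h (iterate S h n x)"
proof -
  let ?g = "inv_into S h"
  have g: "?g y \<in> S" "h (?g y) = y" and hS: "h y \<in> S" if "y \<in> S" for y
    using that h by (auto simp: bij_betw_def intro: inv_into_into f_inv_into_f)
  have pow: "(h ^^ k) x \<in> S" "(?g ^^ k) x \<in> S" for k
    by (induction k) (use x g hS in auto)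
  show "iterate S h n x \<in> S"
    using x pow by (simp add: iterate_def)
  show "iterate S h (n + 1) x = h (iterate S h n x)"
  proof (cases "n \<ge> 0")
    case True
    then show ?thesis
      using x by (simp add: iterate_def nat_add_distrib)
  next
    case False
    then obtain k where k: "n = - int (Suc k)"
      by (metis negD not_le)
    have "h ((?g ^^ Suc k) x) = (?g ^^ k) x"
      using g(2)[OF pow(2)[of k]] by simp
    moreover have "nat (- (n + 1)) = k" "nat (- n) = Suc k"
      using k by auto
    ultimately show ?thesis
      using x False by (cases "k = 0") (auto simp: iterate_def k)
  qed
qed

text \<open>The equation \<open>f (n + 1) = h (f n)\<close> can be solved upwards, and downwards because \<open>h\<close> is
  injective. Addition of exponents and restriction to an invariant subset both follow from this
  uniqueness, which avoids a case distinction on the signs of the exponents.\<close>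

lemma iterate_unique:
  fixes f :: "int \<Rightarrow> 'a"
  assumes h: "bij_betw h S S" and fS: "\<And>n. f n \<in> S" and step: "\<And>n. f (n + 1) = h (f n)"
  shows "f n = iterate S h n (f 0)"
proof (induction n rule: int_induct[where k = 0])
  case base
  then show ?case using fS by (simp add: iterate_0)
next
  case (step1 i)
  then show ?case using iterate_step(2)[OF h fS] step by metis
next
  case (step2 i)
  have "h (f (i - 1)) = h (iterate S h (i - 1) (f 0))"
    using step2 iterate_step(2)[OF h fS, of "i - 1" 0] step[of "i - 1"] by simp
  then show ?case
    using h fS iterate_step(1)[OF h fS] by (meson bij_betw_imp_inj_on inj_onD)
qed

lemma iterate_add:
  assumes "bij_betw h S S" "x \<in> S"
  shows "iterate S h (m + n) x = iterate S h m (iterate S h n x)"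
proof -
  have "iterate S h (m + 1 + n) x = h (iterate S h (m + n) x)" for m
    using iterate_step(2)[OF assms, of "m + n"] by (simp add: algebra_simps)
  then show ?thesis
    using iterate_unique[of h S "\<lambda>m. iterate S h (m + n) x" m] assms
      iterate_step(1)[OF assms] by simp
qed

lemma iterate_inverse:
  assumes "bij_betw h S S" "x \<in> S"
  shows "iterate S h (- n) (iterate S h n x) = x"
  using iterate_add[OF assms, of "- n" n] assms by (simp add: iterate_0)

lemma compose_iterate:
  assumes "bij_betw h S S"
  shows "compose S (iterate S h m) (iterate S h n) = iterate S h (m + n)"
  by (rule extensionalityI[of _ S])
    (auto simp: compose_eq iterate_extensional iterate_add[OF assms])

lemma iterate_restrict:
  assumes h: "bij_betw h S S" and A: "A \<subseteq> S" "h ` A = A" and x: "x \<in> A"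
  shows "iterate A (restrict h A) n x = iterate S h n x"
proof -
  have hA: "bij_betw (restrict h A) A A"
    using h A by (metis bij_betw_def bij_betw_restrict_eq inj_on_subset)
  have "iterate A (restrict h A) (n + 1) x = h (iterate A (restrict h A) n x)" for n
    using iterate_step[OF hA x] by simp
  moreover have "iterate A (restrict h A) 0 x = x"
    using x by (simp add: iterate_0)
  ultimately show ?thesis
    using iterate_unique[OF h, of "\<lambda>n. iterate A (restrict h A) n x" n]
      iterate_step(1)[OF hA x] A by auto
qed

lemma bij_betw_homeomorphic_map:
  "homeomorphic_map X X h \<Longrightarrow> bij_betw h (topspace X) (topspace X)"
  by (simp add: bij_betw_def homeomorphic_imp_injective_map homeomorphic_imp_surjective_map)

lemma homeomorphic_map_iterate:
  assumes "homeomorphic_map X X h"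
  shows "homeomorphic_map X X (iterate (topspace X) h n)"
proof -
  let ?S = "topspace X"
  note h = bij_betw_homeomorphic_map[OF assms]
  obtain g where g: "homeomorphic_maps X X h g"
    using assms homeomorphic_map_maps by blast
  then have cont: "continuous_map X X h" "continuous_map X X g"
    and gh: "\<And>x. x \<in> ?S \<Longrightarrow> g (h x) = x"
    by (auto simp: homeomorphic_maps_def)
  have iter: "continuous_map X X (iterate ?S h n)" for n
  proof (induction n rule: int_induct[where k = 0])
    case base
    show ?case
      by (rule continuous_map_eq[OF continuous_map_id]) (simp add: iterate_0)
  next
    case (step1 i)
    show ?case
      by (rule continuous_map_eq[OF continuous_map_compose[OF step1(2) cont(1)]])
        (simp add: iterate_step[OF h])
  next
    case (step2 i)
    show ?case
    proof (rule continuous_map_eq[OF continuous_map_compose[OF step2(2) cont(2)]])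
      fix x assume x: "x \<in> ?S"
      show "(g \<circ> iterate ?S h i) x = iterate ?S h (i - 1) x"
        using iterate_step[OF h x, of "i - 1"] gh by simp
    qed
  qed
  have "homeomorphic_maps X X (iterate ?S h n) (iterate ?S h (- n))"
    using iter iterate_inverse[OF h, of _ n] iterate_inverse[OF h, of _ "- n"]
    by (simp add: homeomorphic_maps_def)
  then show ?thesis
    by (rule homeomorphic_maps_imp_map)
qed

section \<open>Metrics, finite subcovers and equicontinuity\<close>

lemma compactin_finite_subfamily:
  assumes K: "compactin X K" and V: "\<And>i. i \<in> A \<Longrightarrow> openin X (V i)" "K \<subseteq> \<Union>(V ` A)"
  obtains F where "finite F" "F \<subseteq> A" "K \<subseteq> \<Union>(V ` F)"
proof -
  have "openin X U" if "U \<in> V ` A" for U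
    using V(1) that by auto
  from compactinD[OF K this V(2)]
  obtain \<F> where \<F>: "finite \<F>" "\<F> \<subseteq> V ` A" "K \<subseteq> \<Union>\<F>"
    by auto
  from finite_subset_image[OF \<F>(1,2)] obtain F where "F \<subseteq> A" "finite F" "\<F> = V ` F"
    by auto
  then show thesis
    using that \<F>(3) by simp
qed

lemma metric_forD:
  assumes "metric_for X d"
  shows "Metric_space (topspace X) d" "Metric_space.mtopology (topspace X) d = X"
  using assms by (auto simp: metric_for_def)

lemma Hausdorff_space_metric_for: "metric_for X d \<Longrightarrow> Hausdorff_space X"
  by (metis metric_for_def metrizable_imp_Hausdorff_space Metric_space.metrizable_space_mtopology)

lemma metric_for_subtopology:
  assumes "metric_for X d" "A \<subseteq> topspace X"
  shows "metric_for (subtopology X A) d"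
proof -
  interpret Submetric "topspace X" d A
    using assms by (simp add: Submetric_def Submetric_axioms_def metric_for_def)
  show ?thesis
    using assms sub.Metric_space_axioms mtopology_submetric
    by (simp add: metric_for_def Int_absorb1)
qed

lemma continuous_map_metric_forE:
  assumes "continuous_map X Y f" "metric_for X d" "metric_for Y d'" "a \<in> topspace X" "\<epsilon> > 0"
  obtains \<delta> where "\<delta> > 0" "\<And>x. x \<in> topspace X \<Longrightarrow> d a x < \<delta> \<Longrightarrow> d' (f a) (f x) < \<epsilon>"
  using Metric_space.metric_continuous_map[of "topspace X" d "topspace Y" d' f] assms
  by (simp add: metric_for_def) metis

lemma continuous_map_into_metric:
  assumes "metric_for Y d"
  shows "continuous_map X Y f \<longleftrightarrow> (\<forall>x\<in>topspace X. \<forall>\<epsilon>>0. \<exists>U. openin X U \<and> x \<in> U \<and>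
    (\<forall>y\<in>U. f y \<in> Metric_space.mball (topspace Y) d (f x) \<epsilon>))"
  using Metric_space.continuous_map_to_metric[OF metric_forD(1)[OF assms], of X f]
  by (simp only: metric_forD(2)[OF assms])

text \<open>If equicontinuity fails at \<open>a\<close>, then it already fails along a sequence converging to \<open>a\<close>, and
  such a sequence together with its limit is compact. This replaces compact neighbourhoods, which
  a metrizable space need not have.\<close>

lemma equicontinuous_if_on_compacts:
  assumes X: "metric_for X d" and F: "F \<subseteq> topspace X \<rightarrow> topspace Y"
    and on_compacts: "\<And>K. compactin X K \<Longrightarrow> equicontinuous K d (topspace Y) d' F"
  shows "equicontinuous (topspace X) d (topspace Y) d' F"
  unfolding equicontinuous_def
proof (intro conjI ballI allI impI F)
  fix a \<epsilon> assume a: "a \<in> topspace X" and \<epsilon>: "(0::real) < \<epsilon>"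
  interpret Metric_space "topspace X" d by (rule metric_forD[OF X])
  note [simp] = metric_forD(2)[OF X]
  show "\<exists>\<delta>>0. \<forall>f\<in>F. \<forall>x\<in>topspace X. d a x < \<delta> \<longrightarrow> d' (f a) (f x) < \<epsilon>"
  proof (rule ccontr)
    assume contr: "\<not> ?thesis"
    have "\<exists>x. x \<in> topspace X \<and> d a x < inverse (real (Suc k)) \<and> (\<exists>f\<in>F. \<not> d' (f a) (f x) < \<epsilon>)" for k
      using contr by (metis inverse_positive_iff_positive of_nat_0_less_iff zero_less_Suc)
    then obtain x where x: "\<And>k. x k \<in> topspace X" "\<And>k. d a (x k) < inverse (real (Suc k))"
      and bad: "\<And>k. \<exists>f\<in>F. \<not> d' (f a) (f (x k)) < \<epsilon>"
      by metis
    have "\<exists>N. \<forall>n\<ge>N. d (x n) a < r" if r: "r > 0" for r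
    proof -
      obtain N where "inverse (real (Suc N)) < r"
        using reals_Archimedean[OF r] by blast
      moreover have "inverse (real (Suc n)) \<le> inverse (real (Suc N))" if "n \<ge> N" for n
        using that by (intro le_imp_inverse_le) auto
      ultimately show ?thesis
        by (metis x(2) commute order_less_trans order_less_le_trans)
    qed
    then have "limitin X x a sequentially"
      using a x(1) limit_metric_sequentially[of x a] by simp
    then have "compactin X (insert a (range x))"
      using x by (intro compactin_sequence_with_limit[where \<sigma> = x]) auto
    then obtain \<delta> where \<delta>: "\<delta> > 0"
      "\<forall>f\<in>F. \<forall>y\<in>insert a (range x). d a y < \<delta> \<longrightarrow> d' (f a) (f y) < \<epsilon>"
      using on_compacts \<epsilon> unfolding equicontinuous_def by (meson insertI1)
    obtain k where "inverse (real (Suc k)) < \<delta>"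
      using reals_Archimedean[OF \<delta>(1)] by blast
    then show False
      using \<delta>(2) bad[of k] x(2)[of k] by force
  qed
qed

text \<open>A Lebesgue number, for the first metric, of the cover by small balls of the second one.\<close>

lemma metrics_uniformly_equivalent_on_compact:
  assumes "compact_space X" and d: "metric_for X d" and d': "metric_for X d'" and "\<epsilon> > 0"
  obtains \<delta> where "\<delta> > 0" "\<And>x y. x \<in> topspace X \<Longrightarrow> y \<in> topspace X \<Longrightarrow> d x y < \<delta> \<Longrightarrow> d' x y < \<epsilon>"
proof -
  interpret d: Metric_space "topspace X" d by (rule metric_forD[OF d])
  interpret d': Metric_space "topspace X" d' by (rule metric_forD[OF d'])
  have X: "d.mtopology = X" "d'.mtopology = X"
    using metric_forD[OF d] metric_forD[OF d'] by simp_all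
  let ?C = "(\<lambda>z. d'.mball z (\<epsilon> / 2)) ` topspace X"
  have "openin X U" if "U \<in> ?C" for U
    using that d'.openin_mball unfolding X(2) by blast
  moreover have "topspace X \<subseteq> \<Union>?C"
    using \<open>\<epsilon> > 0\<close> by auto
  ultimately obtain \<delta> where \<delta>: "\<delta> > 0"
    and ball: "\<And>x. x \<in> topspace X \<Longrightarrow> \<exists>U\<in>?C. d.mball x \<delta> \<subseteq> U"
    using d.lebesgue_number[of "topspace X" ?C] assms(1) by (auto simp: X compact_space_def)
  show thesis
  proof
    fix x y assume xy: "x \<in> topspace X" "y \<in> topspace X" "d x y < \<delta>"
    obtain z where z: "z \<in> topspace X" "d.mball x \<delta> \<subseteq> d'.mball z (\<epsilon> / 2)"
      using ball[OF xy(1)] by blast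
    have "x \<in> d'.mball z (\<epsilon> / 2)" "y \<in> d'.mball z (\<epsilon> / 2)"
      using z(2) xy \<delta> by auto
    then show "d' x y < \<epsilon>"
      using d'.triangle[of x z y] d'.commute[of z x] by auto
  qed (rule \<delta>)
qed

text \<open>Almost periodicity of a restriction \<open>h|\<^sub>A\<close> speaks of some metric on \<open>A\<close>, whereas equicontinuity
  is wanted for a prescribed metric of the whole space; compactness of \<open>A\<close> bridges the two.\<close>

lemma equicontinuous_change_metric:
  assumes X: "compact_space X" and d: "metric_for X d" and d': "metric_for X d'"
    and F: "equicontinuous (topspace X) d (topspace X) d F"
  shows "equicontinuous (topspace X) d' (topspace X) d' F"
  unfolding equicontinuous_def
proof (intro conjI ballI allI impI)
  show maps: "F \<subseteq> topspace X \<rightarrow> topspace X"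
    using F by (simp add: equicontinuous_def)
  fix a \<epsilon> assume a: "a \<in> topspace X" and \<epsilon>: "(0::real) < \<epsilon>"
  obtain \<eta> where \<eta>: "\<eta> > 0"
    "\<And>x y. x \<in> topspace X \<Longrightarrow> y \<in> topspace X \<Longrightarrow> d x y < \<eta> \<Longrightarrow> d' x y < \<epsilon>"
    using metrics_uniformly_equivalent_on_compact[OF X d d' \<epsilon>] by metis
  obtain \<delta> where \<delta>: "\<delta> > 0" "\<forall>f\<in>F. \<forall>x\<in>topspace X. d a x < \<delta> \<longrightarrow> d (f a) (f x) < \<eta>"
    using F a \<eta>(1) unfolding equicontinuous_def by metis
  obtain \<delta>' where \<delta>': "\<delta>' > 0"
    "\<And>x y. x \<in> topspace X \<Longrightarrow> y \<in> topspace X \<Longrightarrow> d' x y < \<delta>' \<Longrightarrow> d x y < \<delta>"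
    using metrics_uniformly_equivalent_on_compact[OF X d' d \<delta>(1)] by metis
  have "d' (f a) (f x) < \<epsilon>" if "f \<in> F" "x \<in> topspace X" "d' a x < \<delta>'" for f x
    using that a maps \<eta>(2)[of "f a" "f x"] \<delta>(2) \<delta>'(2)[of a x] by (auto simp: Pi_iff)
  then show "\<exists>\<delta>>0. \<forall>f\<in>F. \<forall>x\<in>topspace X. d' a x < \<delta> \<longrightarrow> d' (f a) (f x) < \<epsilon>"
    using \<delta>'(1) by blast
qed

section \<open>From almost periodicity to equicontinuity\<close>

text \<open>Every exponent is \<open>n = i + j\<close>, where \<open>h\<^sup>i\<close> is uniformly close to the identity and
  \<open>0 \<le> j \<le> N\<close>. So, up to a uniform error, only the finitely many maps \<open>h\<^sup>0, \<dots>, h\<^sup>N\<close> occur, and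
  finitely many continuous maps are equicontinuous.\<close>

lemma equicontinuous_iterates_if_almost_periodic:
  assumes X: "metric_for X d" and ap: "almost_periodic (topspace X) d h"
  shows "equicontinuous (topspace X) d (topspace X) d (range (iterate (topspace X) h))"
  unfolding equicontinuous_def
proof (intro conjI ballI allI impI)
  let ?S = "topspace X"
  let ?g = "iterate ?S h"
  interpret Metric_space ?S d by (rule metric_forD[OF X])
  have hom: "homeomorphic_map X X h"
    using ap metric_forD(2)[OF X] by (simp add: almost_periodic_def)
  note h = bij_betw_homeomorphic_map[OF hom]
  note gS = iterate_step(1)[OF h]
  show "range ?g \<subseteq> ?S \<rightarrow> ?S"
    using gS by auto
  fix a \<epsilon> assume a: "a \<in> ?S" and \<epsilon>: "(0::real) < \<epsilon>"
  obtain N :: int where N: "N \<ge> 0"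
    "\<And>M. \<exists>i. M \<le> i \<and> i \<le> M + N \<and> (\<forall>x\<in>?S. d (?g i x) x < \<epsilon> / 3)"
    using ap[unfolded almost_periodic_def, THEN conjunct2, rule_format, of "\<epsilon> / 3"] \<epsilon> by auto
  have "\<exists>\<delta>>0. \<forall>x. x \<in> ?S \<and> d a x < \<delta> \<longrightarrow> d (?g j a) (?g j x) < \<epsilon> / 3" for j
    using continuous_map_metric_forE[OF _ X X a, of "?g j" "\<epsilon> / 3"] \<epsilon>
      homeomorphic_imp_continuous_map[OF homeomorphic_map_iterate[OF hom, of j]]
    by (metis divide_pos_pos zero_less_numeral)
  then obtain \<delta> where \<delta>: "\<And>j. \<delta> j > (0::real)"
    "\<And>j x. x \<in> ?S \<Longrightarrow> d a x < \<delta> j \<Longrightarrow> d (?g j a) (?g j x) < \<epsilon> / 3"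
    by metis
  define \<delta>\<^sub>0 where "\<delta>\<^sub>0 = Min (\<delta> ` {0..N})"
  have "\<delta>\<^sub>0 > 0"
    using N(1) \<delta>(1) by (simp add: \<delta>\<^sub>0_def)
  moreover have "d (?g n a) (?g n x) < \<epsilon>" if x: "x \<in> ?S" "d a x < \<delta>\<^sub>0" for n x
  proof -
    obtain i where i: "n - N \<le> i" "i \<le> n" "\<And>y. y \<in> ?S \<Longrightarrow> d (?g i y) y < \<epsilon> / 3"
      using N(2)[of "n - N"] by auto
    define j where "j = n - i"
    have "\<delta>\<^sub>0 \<le> \<delta> j"
      using i by (auto simp: \<delta>\<^sub>0_def j_def)
    then have mid: "d (?g j a) (?g j x) < \<epsilon> / 3"
      using \<delta>(2) x by force
    have n: "?g n y = ?g i (?g j y)" if "y \<in> ?S" for y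
      using iterate_add[OF h that, of i j] by (simp add: j_def)
    have "d (?g n a) (?g n x) \<le> d (?g n a) (?g j a) + d (?g j a) (?g j x) + d (?g j x) (?g n x)"
      using triangle[of "?g n a" "?g j a" "?g n x"] triangle[of "?g j a" "?g j x" "?g n x"]
        gS a x by simp
    also have "\<dots> < \<epsilon>"
      using mid i(3)[OF gS[OF a, of j]] i(3)[OF gS[OF x(1), of j]] n[OF a] n[OF x(1)]
        commute[of "?g n x" "?g j x"] by simp
    finally show ?thesis .
  qed
  ultimately show "\<exists>\<delta>>0. \<forall>f\<in>range ?g. \<forall>x\<in>?S. d a x < \<delta> \<longrightarrow> d (f a) (f x) < \<epsilon>"
    by blast
qed

text \<open>A compact set \<open>K\<close> lies in the compact invariant set \<open>A\<close> that is the closure of the union of all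
  \<open>h\<^sup>n(K)\<close>, on which \<open>h\<close> is almost periodic. So equicontinuity is available on every compact set,
  and these determine it on the whole space.\<close>

lemma equicontinuous_iterates_if_compactly_almost_periodic:
  assumes X: "metric_for X d" and cap: "compactly_almost_periodic X h"
  shows "equicontinuous (topspace X) d (topspace X) d (range (iterate (topspace X) h))"
proof (rule equicontinuous_if_on_compacts[OF X])
  let ?S = "topspace X"
  let ?g = "iterate ?S h"
  have hom: "homeomorphic_map X X h"
    using cap by (simp add: compactly_almost_periodic_def)
  note h = bij_betw_homeomorphic_map[OF hom]
  note gS = iterate_step(1)[OF h]
  show maps: "range ?g \<subseteq> ?S \<rightarrow> ?S"
    using gS by auto
  fix K assume K: "compactin X K"
  then have KS: "K \<subseteq> ?S"
    by (rule compactin_subset_topspace)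
  define B where "B = (\<Union>n. ?g n ` K)"
  define A where "A = X closure_of B"
  have A: "compactin X A"
    using cap K by (simp add: compactly_almost_periodic_def A_def B_def)
  have AS: "A \<subseteq> ?S" and BS: "B \<subseteq> ?S"
    using gS KS by (auto simp: A_def B_def closure_of_subset_topspace)
  have "h ` B = (\<Union>n. ?g (n + 1) ` K)"
    unfolding B_def image_UN image_image
    by (intro SUP_cong refl image_cong) (use iterate_step(2)[OF h] KS in auto)
  also have "\<dots> = (\<Union>n\<in>range (\<lambda>n. n + 1). ?g n ` K)"
    by blast
  also have "range (\<lambda>n. n + 1) = (UNIV :: int set)"
    by (rule surjI[of _ "\<lambda>n. n - 1"]) simp
  finally have "h ` B = B"
    unfolding B_def .
  then have hA: "h ` A = A"
    using homeomorphic_map_closure_of[OF hom BS] by (simp add: A_def)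
  have "K \<subseteq> B"
  proof
    fix x assume "x \<in> K"
    then have "?g 0 x = x" using KS by (auto simp: iterate_0)
    then show "x \<in> B" using \<open>x \<in> K\<close> unfolding B_def by (metis UN_I UNIV_I image_eqI)
  qed
  then have KA: "K \<subseteq> A"
    using closure_of_subset[OF BS] by (simp add: A_def)
  obtain d' where d': "metric_for (subtopology X A) d'" "almost_periodic A d' (restrict h A)"
    using cap A hA by (auto simp: compactly_almost_periodic_def)
  have topspace_A: "topspace (subtopology X A) = A"
    using AS by (simp add: Int_absorb1)
  have "equicontinuous A d' A d' (range (iterate A (restrict h A)))"
    using equicontinuous_iterates_if_almost_periodic[OF d'(1), unfolded topspace_A] d'(2) by simp
  then have "equicontinuous A d A d (range (iterate A (restrict h A)))"
    using equicontinuous_change_metric[OF _ d'(1) metric_for_subtopology[OF X AS],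
        unfolded topspace_A] A
    by (simp add: compact_space_subtopology)
  then have equi_A: "\<exists>\<delta>>0. \<forall>f\<in>range (iterate A (restrict h A)). \<forall>x\<in>A. d a x < \<delta> \<longrightarrow> d (f a) (f x) < \<epsilon>"
    if "a \<in> A" "\<epsilon> > 0" for a \<epsilon>
    using that unfolding equicontinuous_def by blast
  show "equicontinuous K d ?S d (range ?g)"
    unfolding equicontinuous_def
  proof (intro conjI ballI allI impI)
    show "range ?g \<subseteq> K \<rightarrow> ?S"
      using maps KS by blast
    fix a \<epsilon> assume a: "a \<in> K" and "(0::real) < \<epsilon>"
    then obtain \<delta> where \<delta>: "\<delta> > 0"
      "\<And>n x. x \<in> A \<Longrightarrow> d a x < \<delta> \<Longrightarrow> d (iterate A (restrict h A) n a) (iterate A (restrict h A) n x) < \<epsilon>"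
      using equi_A[of a \<epsilon>] KA by blast
    have "d (?g n a) (?g n x) < \<epsilon>" if x: "x \<in> K" "d a x < \<delta>" for n x
    proof -
      have "a \<in> A" "x \<in> A"
        using a x KA by blast+
      then show ?thesis
        using \<delta>(2)[of x n] x(2) by (simp add: iterate_restrict[OF h AS hA])
    qed
    then show "\<exists>\<delta>>0. \<forall>f\<in>range ?g. \<forall>x\<in>K. d a x < \<delta> \<longrightarrow> d (f a) (f x) < \<epsilon>"
      using \<delta>(1) by blast
  qed
qed

section \<open>From compactness in the compact-open topology to equicontinuity\<close>

text \<open>The necessity half of Ascoli's theorem. On a compact \<open>K\<close>, each \<open>f \<in> H\<close> maps a small
  closed ball of \<open>K\<close> about \<open>a\<close> into a small ball about \<open>f a\<close>. That ball of \<open>K\<close> is compact,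
  so the condition is open in \<open>f\<close>, and finitely many such conditions cover \<open>H\<close>.\<close>

lemma equicontinuous_if_compact_open_compact:
  assumes X: "metric_for X d" and H: "compactin (compact_open_topology X) H"
  shows "equicontinuous (topspace X) d (topspace X) d H"
proof (rule equicontinuous_if_on_compacts[OF X])
  let ?S = "topspace X"
  interpret Metric_space ?S d by (rule metric_forD[OF X])
  note [simp] = metric_forD(2)[OF X]
  have cont: "continuous_map X X f" if "f \<in> H" for f
    using compactin_subset_topspace[OF H] that by (auto simp: continuous_self_maps_def)
  show maps: "H \<subseteq> ?S \<rightarrow> ?S"
    using cont by (auto dest: continuous_map_funspace)
  fix K assume K: "compactin X K"
  then have KS: "K \<subseteq> ?S"
    by (rule compactin_subset_topspace)
  show "equicontinuous K d ?S d H"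
    unfolding equicontinuous_def
  proof (intro conjI ballI allI impI)
    show "H \<subseteq> K \<rightarrow> ?S"
      using maps KS by blast
    fix a \<epsilon> assume a: "a \<in> K" and \<epsilon>: "(0::real) < \<epsilon>"
    have "\<exists>r>0. f ` (K \<inter> mcball a r) \<subseteq> mball (f a) (\<epsilon> / 2)" if f: "f \<in> H" for f
    proof -
      have "a \<in> ?S"
        using a KS by blast
      then obtain \<delta> where "\<delta> > 0" "\<And>x. x \<in> ?S \<Longrightarrow> d a x < \<delta> \<Longrightarrow> d (f a) (f x) < \<epsilon> / 2"
        using continuous_map_metric_forE[OF cont[OF f] X X, of a "\<epsilon> / 2"] \<epsilon> by auto
      then show ?thesis
        using f a KS maps by (intro exI[of _ "\<delta> / 2"]) (fastforce simp: Pi_iff)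
    qed
    then obtain r where r: "\<And>f. f \<in> H \<Longrightarrow> r f > 0"
      "\<And>f. f \<in> H \<Longrightarrow> f ` (K \<inter> mcball a (r f)) \<subseteq> mball (f a) (\<epsilon> / 2)"
      by metis
    define V where "V f = {g \<in> continuous_self_maps X.
      g ` (K \<inter> mcball a (r f)) \<subseteq> mball (f a) (\<epsilon> / 2)}" for f
    have open_V: "openin (compact_open_topology X) (V f)" for f
    proof -
      have "compactin X (K \<inter> mcball a (r f))"
        using compact_Int_closedin[OF K] closedin_mcball by simp
      moreover have "openin X (mball (f a) (\<epsilon> / 2))"
        using openin_mball by simp
      ultimately show ?thesis
        unfolding compact_open_topology_def V_def by (intro topology_generated_by_Basis) blast
    qed
    have cover: "H \<subseteq> \<Union>(V ` H)"
      using r(2) cont compactin_subset_topspace[OF H] by (fastforce simp: V_def)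
    obtain F where F: "finite F" "F \<subseteq> H" "H \<subseteq> \<Union>(V ` F)"
      by (rule compactin_finite_subfamily[OF H open_V cover])
    define \<delta> where "\<delta> = Min (insert 1 (r ` F))"
    have "\<delta> > 0"
      using F r(1) by (auto simp: \<delta>_def)
    moreover have "d (g a) (g x) < \<epsilon>" if g: "g \<in> H" and x: "x \<in> K" "d a x < \<delta>" for g x
    proof -
      obtain f where f: "f \<in> F" "g \<in> V f"
        using F(3) g by blast
      then have "\<delta> \<le> r f"
        using F(1) by (simp add: \<delta>_def)
      then have "x \<in> K \<inter> mcball a (r f)" "a \<in> K \<inter> mcball a (r f)"
        using f(1) x a KS r(1)[of f] F(2) mdist_zero[of a] by force+
      then have "g a \<in> mball (f a) (\<epsilon> / 2)" "g x \<in> mball (f a) (\<epsilon> / 2)"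
        using f(2) unfolding V_def by blast+
      then show ?thesis
        using triangle[of "g a" "f a" "g x"] commute[of "g a" "f a"] by auto
    qed
    ultimately show "\<exists>\<delta>>0. \<forall>f\<in>H. \<forall>x\<in>K. d a x < \<delta> \<longrightarrow> d (f a) (f x) < \<epsilon>"
      by blast
  qed
qed

section \<open>From equicontinuity to an invariant metric\<close>

text \<open>The supremum of a bounded metric over all its translates by \<open>h\<^sup>n\<close> is invariant, since applying
  \<open>h\<close> only shifts the index. It is finer than the original metric because the index \<open>0\<close> occurs,
  and equicontinuity says exactly that it is not strictly finer as a topology.\<close>

lemma invariant_metric_if_equicontinuous:
  assumes X: "metric_for X d" and h: "bij_betw h (topspace X) (topspace X)"
    and equi: "equicontinuous (topspace X) d (topspace X) d (range (iterate (topspace X) h))"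
  obtains d' where "metric_for X d'"
    "\<forall>x\<in>topspace X. \<forall>y\<in>topspace X. d' x y = d' (h x) (h y)"
proof -
  let ?S = "topspace X"
  let ?g = "iterate ?S h"
  interpret Metric_space ?S d by (rule metric_forD[OF X])
  note gS = iterate_step(1)[OF h]
  (* Truncation at 1 keeps the supremum finite. *)
  define e where "e x y n = min 1 (d (?g n x) (?g n y))" for x y n
  define d' where "d' x y = (SUP n. e x y n)" for x y
  have bdd: "bdd_above (range (e x y))" for x y
    by (rule bdd_aboveI[of _ 1]) (auto simp: e_def)
  have e_le: "e x y n \<le> d' x y" for x y n
    unfolding d'_def by (rule cSUP_upper[OF _ bdd]) simp
  have le: "d' x y \<le> c" if "\<And>n. e x y n \<le> c" for x y c
    unfolding d'_def by (rule cSUP_least) (use that in auto)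
  have d_le: "min 1 (d x y) \<le> d' x y" if "x \<in> ?S" "y \<in> ?S" for x y
    using e_le[of x y 0] that by (simp add: e_def iterate_0)
  interpret d': Metric_space ?S d'
  proof
    show "0 \<le> d' x y" for x y
      by (rule order_trans[OF _ e_le[of x y 0]]) (simp add: e_def)
    show "d' x y = d' y x" for x y
      by (simp add: d'_def e_def commute)
    show "d' x y = 0 \<longleftrightarrow> x = y" if xy: "x \<in> ?S" "y \<in> ?S" for x y
    proof
      assume "d' x y = 0"
      then have "d x y \<le> 0"
        using d_le[OF xy] by (auto simp: min_def split: if_splits)
      then show "x = y"
        using xy nonneg[of x y] by simp
    next
      assume "x = y"
      then show "d' x y = 0"
        using xy gS by (simp add: d'_def e_def)
    qed
    show "d' x z \<le> d' x y + d' y z" if xyz: "x \<in> ?S" "y \<in> ?S" "z \<in> ?S" for x y z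
    proof (rule le)
      fix n
      have "e x z n \<le> e x y n + e y z n"
        using triangle[OF gS[OF xyz(1)] gS[OF xyz(2)] gS[OF xyz(3)], of n n n]
          nonneg[of "?g n x" "?g n y"] nonneg[of "?g n y" "?g n z"]
        unfolding e_def by linarith
      then show "e x z n \<le> d' x y + d' y z"
        using e_le[of x y n] e_le[of y z n] by simp
    qed
  qed
  have finer: "\<exists>\<delta>>0. mball x \<delta> \<subseteq> d'.mball x r" if r: "r > 0" for x r
  proof (cases "x \<in> ?S")
    case True
    obtain \<delta> where \<delta>: "\<delta> > 0" "\<forall>f\<in>range ?g. \<forall>y\<in>?S. d x y < \<delta> \<longrightarrow> d (f x) (f y) < r / 2"
      using equi[unfolded equicontinuous_def, THEN conjunct2, rule_format, of x "r / 2"] True r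
      by auto
    have "d' x y < r" if "y \<in> ?S" "d x y < \<delta>" for y
    proof -
      have "e x y n \<le> r / 2" for n
      proof -
        have "d (?g n x) (?g n y) < r / 2"
          using \<delta>(2) that by blast
        then show ?thesis
          unfolding e_def by linarith
      qed
      then show ?thesis
        using le[of x y "r / 2"] r by simp
    qed
    then show ?thesis
      using \<delta>(1) by (auto intro!: exI[of _ \<delta>])
  qed (use r in \<open>auto intro: exI[of _ 1]\<close>)
  have coarser: "\<exists>\<delta>>0. d'.mball x \<delta> \<subseteq> mball x r" if r: "r > 0" for x r
  proof (intro exI conjI subsetI)
    show "min 1 r > 0" using r by simp
    fix y assume "y \<in> d'.mball x (min 1 r)"
    then show "y \<in> mball x r"
      using d_le[of x y] by (auto simp: min_def split: if_splits)
  qed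
  have "d'.mtopology = X"
  proof -
    have "openin d'.mtopology U \<longleftrightarrow> openin mtopology U" for U
      unfolding openin_mtopology d'.openin_mtopology
      using finer coarser by (meson subset_trans)
    then show ?thesis
      using metric_forD(2)[OF X] by (simp add: topology_eq)
  qed
  then have "metric_for X d'"
    by (simp add: metric_for_def d'.Metric_space_axioms)
  moreover have "d' (h x) (h y) = d' x y" if xy: "x \<in> ?S" "y \<in> ?S" for x y
  proof -
    have "?g n (h z) = ?g (n + 1) z" if "z \<in> ?S" for n z
      using iterate_add[OF h that, of n 1] iterate_step(2)[OF h that, of 0] that
      by (simp add: iterate_0)
    then have "e (h x) (h y) = e x y \<circ> (\<lambda>n. n + 1)"
      using xy by (auto simp: e_def)
    moreover have "range (\<lambda>n. n + 1) = (UNIV :: int set)"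
      by (rule surjI[of _ "\<lambda>n. n - 1"]) simp
    ultimately show ?thesis
      by (metis d'_def image_comp)
  qed
  ultimately show thesis
    using that by simp
qed

section \<open>From an invariant metric to compact almost periodicity\<close>

lemma distance_iterate:
  assumes h: "bij_betw h S S" and iso: "\<forall>x\<in>S. \<forall>y\<in>S. d x y = d (h x) (h y)"
    and xy: "x \<in> S" "y \<in> S"
  shows "d (iterate S h n x) (iterate S h n y) = d x y"
proof -
  have step: "d (iterate S h (n + 1) x) (iterate S h (n + 1) y) = d (iterate S h n x) (iterate S h n y)"
    for n
    using bspec[OF bspec[OF iso iterate_step(1)[OF h xy(1), of n]] iterate_step(1)[OF h xy(2), of n]]
      iterate_step(2)[OF h xy(1)] iterate_step(2)[OF h xy(2)] by simp
  show ?thesis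
  proof (induction n rule: int_induct[where k = 0])
    case base
    show ?case using xy by (simp add: iterate_0)
  next
    case (step1 i)
    then show ?case using step by simp
  next
    case (step2 i)
    then show ?case using step[of "i - 1"] by simp
  qed
qed

text \<open>Given points \<open>h\<^sup>n(b)\<close> with varying \<open>n\<close> and \<open>b \<in> B\<close>, pass to a subsequence along which \<open>b\<close>
  converges to some \<open>c\<close>, and to a further one along which \<open>h\<^sup>n(c)\<close> converges, which is possible
  because the orbit of \<open>c\<close> has compact closure. As \<open>h\<^sup>n\<close> preserves the distance from \<open>b\<close> to \<open>c\<close>,
  the points \<open>h\<^sup>n(b)\<close> have the same limit.\<close>

lemma compact_closure_saturation_if_isometry:
  assumes X: "metric_for X d" and h: "bij_betw h (topspace X) (topspace X)"
    and iso: "\<forall>x\<in>topspace X. \<forall>y\<in>topspace X. d x y = d (h x) (h y)"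
    and orbits: "\<forall>x\<in>topspace X.
           compactin X (X closure_of (range (\<lambda>n. iterate (topspace X) h n x)))"
    and B: "compactin X B"
  shows "compactin X (X closure_of (\<Union>n. iterate (topspace X) h n ` B))"
proof -
  let ?S = "topspace X"
  let ?g = "iterate ?S h"
  interpret Metric_space ?S d by (rule metric_forD[OF X])
  note mtop [simp] = metric_forD(2)[OF X]
  note gS = iterate_step(1)[OF h]
  have BS: "B \<subseteq> ?S"
    by (rule compactin_subset_topspace[OF B])
  define U where "U = (\<Union>n. ?g n ` B)"
  have US: "U \<subseteq> ?S"
    using BS gS by (auto simp: U_def)
  have "\<exists>l r. l \<in> ?S \<and> strict_mono r \<and> limitin X (\<sigma> \<circ> r) l sequentially"
    if \<sigma>: "range \<sigma> \<subseteq> U" for \<sigma> :: "nat \<Rightarrow> 'a"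
  proof -
    have "\<exists>n b. b \<in> B \<and> \<sigma> k = ?g n b" for k
      using subsetD[OF \<sigma> rangeI, of k] unfolding U_def by blast
    then obtain n b where b: "\<And>k. b k \<in> B" and \<sigma>_eq: "\<And>k. \<sigma> k = ?g (n k) (b k)"
      by metis
    obtain c r where c: "c \<in> B" and r: "strict_mono r"
      and lim_c: "limitin X (b \<circ> r) c sequentially"
      using compactin_sequentially[of B, unfolded mtop] B b by (metis image_subsetI)
    then have cS: "c \<in> ?S" using BS by blast
    let ?C = "X closure_of (range (\<lambda>n. ?g n c))"
    have "range (\<lambda>n. ?g n c) \<subseteq> ?C"
      using gS[OF cS] by (intro closure_of_subset) auto
    then have "range (\<lambda>k. ?g (n (r k)) c) \<subseteq> ?C"
      by blast
    then obtain l s where l: "l \<in> ?C" and s: "strict_mono s"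
      and lim_l: "limitin X ((\<lambda>k. ?g (n (r k)) c) \<circ> s) l sequentially"
      using compactin_sequentially[of ?C, unfolded mtop] bspec[OF orbits cS] by blast
    have lS: "l \<in> ?S"
      using limitin_topspace[OF lim_l] .
    have "\<exists>N. \<forall>k\<ge>N. (\<sigma> \<circ> (r \<circ> s)) k \<in> ?S \<and> d ((\<sigma> \<circ> (r \<circ> s)) k) l < \<epsilon>" if \<epsilon>: "\<epsilon> > 0" for \<epsilon>
    proof -
      obtain N1 where N1: "\<And>k. k \<ge> N1 \<Longrightarrow> d (b (r k)) c < \<epsilon> / 2"
        using lim_c \<epsilon> limit_metric_sequentially[of "b \<circ> r" c, unfolded mtop]
        by (metis comp_apply half_gt_zero)
      obtain N2 where N2: "\<And>k. k \<ge> N2 \<Longrightarrow> d (?g (n (r (s k))) c) l < \<epsilon> / 2"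
        using lim_l \<epsilon> limit_metric_sequentially[of "(\<lambda>k. ?g (n (r k)) c) \<circ> s" l, unfolded mtop]
        by (metis comp_apply half_gt_zero)
      have "d (\<sigma> (r (s k))) l < \<epsilon>" if k: "k \<ge> max N1 N2" for k
      proof -
        let ?k = "r (s k)"
        have bS: "b ?k \<in> ?S" using b BS by blast
        have "d (\<sigma> ?k) l \<le> d (?g (n ?k) (b ?k)) (?g (n ?k) c) + d (?g (n ?k) c) l"
          unfolding \<sigma>_eq by (rule triangle) (use gS bS cS lS in auto)
        also have "d (?g (n ?k) (b ?k)) (?g (n ?k) c) = d (b ?k) c"
          using distance_iterate[where d = d, OF h iso bS cS] by simp
        finally show ?thesis
          using N1[of "s k"] N2[of k] seq_suble[OF s, of k] k by simp
      qed
      then show ?thesis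
        using \<sigma> US by (auto simp: image_subset_iff intro!: exI[of _ "max N1 N2"])
    qed
    then have "limitin X (\<sigma> \<circ> (r \<circ> s)) l sequentially"
      using lS limit_metric_sequentially[of "\<sigma> \<circ> (r \<circ> s)" l, unfolded mtop] by blast
    then show ?thesis
      using lS strict_mono_o[OF r s] by blast
  qed
  then have "\<forall>T. T \<subseteq> U \<and> infinite T \<longrightarrow> ?S \<inter> X derived_set_of T \<noteq> {}"
    using Bolzano_Weierstrass_property[of U ?S, unfolded mtop] US by blast
  then show ?thesis
    using compact_closure_of_eq_Bolzano_Weierstrass[of U, unfolded mtop] unfolding U_def by blast
qed

text \<open>The powers of an isometry of a compact space form a totally bounded family for uniform
  distance: up to \<open>\<epsilon>\<close> there are only finitely many of them. Hence each exponent \<open>n\<close> has an \<open>m\<close> from a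
  finite list of exponents with \<open>h\<^sup>n\<close> and \<open>h\<^sup>m\<close> uniformly \<open>\<epsilon>\<close>-close, and then \<open>h\<^sup>n\<^sup>-\<^sup>m\<close> is
  uniformly \<open>\<epsilon>\<close>-close to the identity.\<close>

lemma almost_periodic_if_compact_isometry:
  assumes "compact_space X" and X: "metric_for X d" and hom: "homeomorphic_map X X h"
    and iso: "\<forall>x\<in>topspace X. \<forall>y\<in>topspace X. d x y = d (h x) (h y)"
  shows "almost_periodic (topspace X) d h"
  unfolding almost_periodic_def
proof (intro conjI allI impI)
  let ?S = "topspace X"
  let ?g = "iterate ?S h"
  interpret Metric_space ?S d by (rule metric_forD[OF X])
  note mtop [simp] = metric_forD(2)[OF X]
  note h = bij_betw_homeomorphic_map[OF hom]
  note gS = iterate_step(1)[OF h]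
  note dist_g = distance_iterate[where d = d, OF h iso]
  show "homeomorphic_map mtopology mtopology h"
    using hom by simp
  fix \<epsilon> :: real assume \<epsilon>: "\<epsilon> > 0"
  have "mtotally_bounded ?S"
    using compactin_imp_mtotally_bounded[of ?S] assms(1) by (simp add: compact_space_def)
  then obtain F where F: "finite F" "F \<subseteq> ?S" "?S \<subseteq> (\<Union>p\<in>F. mball p (\<epsilon> / 4))"
    using \<epsilon> unfolding mtotally_bounded_def by (metis divide_pos_pos zero_less_numeral)
  have "\<exists>q. q \<in> F \<and> d q y < \<epsilon> / 4" if "y \<in> ?S" for y
    using subsetD[OF F(3) that] unfolding UN_iff in_mball by blast
  then obtain q where q: "\<And>y. y \<in> ?S \<Longrightarrow> q y \<in> F" "\<And>y. y \<in> ?S \<Longrightarrow> d (q y) y < \<epsilon> / 4"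
    by metis
  (* For each point of the net F, the pattern \<phi> n names a net point near its image under the n-th
     iterate. There are finitely many patterns, and the pattern determines the iterate up to \<epsilon>. *)
  define \<phi> where "\<phi> n = restrict (\<lambda>p. q (?g n p)) F" for n
  have "range \<phi> \<subseteq> F \<rightarrow>\<^sub>E F"
    using q(1) gS F(2) by (auto simp: \<phi>_def)
  then have fin: "finite (range \<phi>)"
    using finite_PiE[OF F(1), of "\<lambda>_. F"] F(1) finite_subset by blast
  have close: "d (?g n x) (?g m x) < \<epsilon>" if nm: "\<phi> n = \<phi> m" and x: "x \<in> ?S" for n m x
  proof -
    obtain p where p: "p \<in> F" "d p x < \<epsilon> / 4"
      using subsetD[OF F(3) x] unfolding UN_iff in_mball by blast
    then have pS: "p \<in> ?S" using F(2) by blast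
    have qeq: "q (?g n p) = q (?g m p)"
      using fun_cong[OF nm, of p] p(1) by (simp add: \<phi>_def)
    let ?q = "q (?g n p)"
    have qS: "?q \<in> ?S"
      using q(1)[OF gS[OF pS]] F(2) by blast
    have "d (?g n x) (?g m x)
      \<le> d (?g n x) (?g n p) + d (?g n p) ?q + d ?q (?g m p) + d (?g m p) (?g m x)"
      using triangle[of "?g n x" "?g n p" "?g m x"] triangle[of "?g n p" ?q "?g m x"]
        triangle[of ?q "?g m p" "?g m x"] gS x pS qS by simp
    also have "\<dots> < \<epsilon>"
      using dist_g[OF x pS, of n] dist_g[OF pS x, of m] p(2) commute[of x p]
        commute[of ?q "?g n p"] q(2)[OF gS[OF pS], of n] q(2)[OF gS[OF pS], of m] qeq by simp
    finally show ?thesis .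
  qed
  define rep where "rep v = (SOME n. \<phi> n = v)" for v
  have rep: "\<phi> (rep (\<phi> n)) = \<phi> n" for n
    unfolding rep_def by (rule someI[where x = n]) simp
  define Q where "Q = Max ((\<lambda>v. \<bar>rep v\<bar>) ` range \<phi>)"
  have Q: "\<bar>rep (\<phi> n)\<bar> \<le> Q" for n
    unfolding Q_def using fin by (intro Max_ge) auto
  show "\<exists>N\<ge>0. \<forall>M. \<exists>i. M \<le> i \<and> i \<le> M + N \<and> (\<forall>x\<in>?S. d (?g i x) x < \<epsilon>)"
  proof (rule exI[of _ "2 * Q"], intro conjI allI)
    show "0 \<le> 2 * Q"
      using Q[of 0] by simp
    fix M
    (* The exponents m are bounded by Q in absolute value, so M + Q - m lies in [M, M + 2 Q]. *)
    define m where "m = rep (\<phi> (M + Q))"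
    have "d (?g (M + Q - m) x) x < \<epsilon>" if x: "x \<in> ?S" for x
    proof -
      have "?g (M + Q - m) x = ?g (M + Q) (?g (- m) x)" "x = ?g m (?g (- m) x)"
        using iterate_add[OF h x, of "M + Q" "- m"] iterate_inverse[OF h x, of "- m"] by simp_all
      then show ?thesis
        using close[of "M + Q" m "?g (- m) x"] rep gS[OF x] by (simp add: m_def)
    qed
    then show "\<exists>i. M \<le> i \<and> i \<le> M + 2 * Q \<and> (\<forall>x\<in>?S. d (?g i x) x < \<epsilon>)"
      using Q[of "M + Q"] by (intro exI[of _ "M + Q - m"]) (auto simp: m_def)
  qed
qed

lemma compactly_almost_periodic_if_isometry:
  assumes X: "metric_for X d" and hom: "homeomorphic_map X X h"
    and iso: "\<forall>x\<in>topspace X. \<forall>y\<in>topspace X. d x y = d (h x) (h y)"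
    and orbits: "\<forall>x\<in>topspace X.
           compactin X (X closure_of (range (\<lambda>n. iterate (topspace X) h n x)))"
  shows "compactly_almost_periodic X h"
  unfolding compactly_almost_periodic_def
proof (intro conjI allI impI hom)
  note h = bij_betw_homeomorphic_map[OF hom]
  show "compactin X (X closure_of (\<Union>n. iterate (topspace X) h n ` B))" if "compactin X B" for B
    by (rule compact_closure_saturation_if_isometry[where d = d, OF X h iso orbits that])
  fix A assume A: "compactin X A \<and> h ` A = A"
  then have AS: "A \<subseteq> topspace X"
    by (simp add: compactin_subset_topspace)
  have topspace_A: "topspace (subtopology X A) = A"
    using AS by (simp add: Int_absorb1)
  have "homeomorphic_map (subtopology X A) (subtopology X A) h"
    using A AS by (intro homeomorphic_map_subtopologies[OF hom]) (auto simp: Int_absorb1)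
  then have "homeomorphic_map (subtopology X A) (subtopology X A) (restrict h A)"
    by (rule homeomorphic_map_eq) (simp add: topspace_A)
  moreover have dA: "metric_for (subtopology X A) d"
    by (rule metric_for_subtopology[OF X AS])
  moreover have "compact_space (subtopology X A)"
    using A by (simp add: compact_space_subtopology)
  moreover have "\<forall>x\<in>A. \<forall>y\<in>A. d x y = d (restrict h A x) (restrict h A y)"
  proof (intro ballI)
    fix x y assume "x \<in> A" "y \<in> A"
    then show "d x y = d (restrict h A x) (restrict h A y)"
      using bspec[OF bspec[OF iso, of x], of y] AS by (simp add: subset_iff)
  qed
  ultimately have "almost_periodic A d (restrict h A)"
    using almost_periodic_if_compact_isometry[of "subtopology X A" d "restrict h A",
        unfolded topspace_A] by blast
  then show "\<exists>d. metric_for (subtopology X A) d \<and> almost_periodic A d (restrict h A)"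
    using dA by blast
qed

section \<open>The topology of distance-preserving maps\<close>

text \<open>Surjectivity is left out: a pointwise limit of distance-preserving maps preserves distances, but
  it need not be surjective, so the bijective ones need not form a closed set. The maps are extensional, which makes
  them points of the product space as well as of the space of continuous self-maps.\<close>

definition isometric_self_maps :: "'a topology \<Rightarrow> ('a \<Rightarrow> 'a \<Rightarrow> real) \<Rightarrow> ('a \<Rightarrow> 'a) set" where
  "isometric_self_maps X d =
     {f \<in> topspace X \<rightarrow>\<^sub>E topspace X. \<forall>x\<in>topspace X. \<forall>y\<in>topspace X. d x y = d (f x) (f y)}"

abbreviation pointwise_topology :: "'a topology \<Rightarrow> ('a \<Rightarrow> 'a) topology" where
  "pointwise_topology X \<equiv> product_topology (\<lambda>_. X) (topspace X)"

lemma isometric_self_mapsD: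
  assumes "f \<in> isometric_self_maps X d"
  shows "x \<in> topspace X \<Longrightarrow> f x \<in> topspace X"
    "x \<in> topspace X \<Longrightarrow> y \<in> topspace X \<Longrightarrow> d (f x) (f y) = d x y"
    "f \<in> extensional (topspace X)"
  using assms by (auto simp: isometric_self_maps_def PiE_iff)

lemma isometric_self_maps_subset_continuous:
  assumes X: "metric_for X d"
  shows "isometric_self_maps X d \<subseteq> continuous_self_maps X"
proof
  interpret Metric_space "topspace X" d by (rule metric_forD[OF X])
  fix f assume f: "f \<in> isometric_self_maps X d"
  have "continuous_map X X f"
    using metric_continuous_map[OF Metric_space_axioms, of f] isometric_self_mapsD[OF f]
    unfolding metric_forD(2)[OF X] by (metis image_subsetI)
  then show "f \<in> continuous_self_maps X"
    using isometric_self_mapsD(3)[OF f] by (simp add: continuous_self_maps_def)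
qed

lemma continuous_map_evaluation_pointwise:
  "x \<in> topspace X \<Longrightarrow> continuous_map (pointwise_topology X) X (\<lambda>f. f x)"
  by (rule continuous_map_product_projection)

lemma closedin_isometric_self_maps:
  assumes X: "metric_for X d"
  shows "closedin (pointwise_topology X) (isometric_self_maps X d)"
proof -
  let ?S = "topspace X"
  let ?P = "pointwise_topology X"
  interpret Metric_space ?S d by (rule metric_forD[OF X])
  have "continuous_map ?P euclideanreal (\<lambda>f. d (f x) (f y))" if "x \<in> ?S" "y \<in> ?S" for x y
    using continuous_map_mdist[of ?P "metric (?S, d)" "\<lambda>f. f x" "\<lambda>f. f y"]
      continuous_map_evaluation_pointwise[OF that(1)] continuous_map_evaluation_pointwise[OF that(2)]
      metric_forD(2)[OF X]
    by (simp add: mtopology_of)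
  then have C: "closedin ?P {f \<in> topspace ?P. d (f x) (f y) \<in> {d x y}}"
    if "x \<in> ?S" "y \<in> ?S" for x y
    using that by (intro closedin_continuous_map_preimage) auto
  show ?thesis
  proof (cases "?S = {}")
    case True
    then have "isometric_self_maps X d = topspace ?P"
      by (simp add: isometric_self_maps_def)
    then show ?thesis
      using closedin_topspace[of ?P] by simp
  next
    case False
    then have "closedin ?P (topspace ?P \<inter>
        (\<Inter>x\<in>?S. \<Inter>y\<in>?S. {f \<in> topspace ?P. d (f x) (f y) \<in> {d x y}}))"
      by (intro closedin_Int closedin_topspace closedin_INT C)
    also have "\<dots> = isometric_self_maps X d"
      by (auto simp: isometric_self_maps_def)
    finally show ?thesis .
  qed
qed

lemma continuous_map_compact_open_pointwise:
  "continuous_map (compact_open_topology X) (pointwise_topology X) (\<lambda>f. f)"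
proof (rule continuous_map_coordinatewise_then_product)
  fix x assume x: "x \<in> topspace X"
  show "continuous_map (compact_open_topology X) X (\<lambda>f. f x)"
    unfolding continuous_map_def
  proof (intro conjI allI impI)
    show "(\<lambda>f. f x) \<in> topspace (compact_open_topology X) \<rightarrow> topspace X"
      using x by (auto simp: continuous_self_maps_def dest: continuous_map_funspace)
    fix U assume U: "openin X U"
    have "compactin X {x}"
      using x by simp
    then have "openin (compact_open_topology X) {f \<in> continuous_self_maps X. f ` {x} \<subseteq> U}"
      unfolding compact_open_topology_def using U by (intro topology_generated_by_Basis) blast
    then show "openin (compact_open_topology X) {f \<in> topspace (compact_open_topology X). f x \<in> U}"
      by simp
  qed
qed (auto simp: continuous_self_maps_def extensional_def)

text \<open>Let \<open>f\<close> and \<open>g\<close> preserve distances. If their values at \<open>c\<close> are less than \<open>r\<close> apart, then \<open>g\<close>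
  maps the ball of radius \<open>r\<close> about \<open>c\<close> into the ball of radius \<open>2 r\<close> about \<open>f c\<close>. So whether \<open>g\<close>
  maps a compact set into an open set is controlled by its values at the finitely many centres of a
  cover, that is, by a pointwise condition.\<close>

lemma compact_open_eq_pointwise_on_isometries:
  assumes X: "metric_for X d"
  defines "I \<equiv> isometric_self_maps X d"
  shows "subtopology (compact_open_topology X) I = subtopology (pointwise_topology X) I"
proof -
  let ?S = "topspace X"
  let ?CO = "compact_open_topology X"
  let ?T = "subtopology (pointwise_topology X) I"
  interpret Metric_space ?S d by (rule metric_forD[OF X])
  note [simp] = metric_forD(2)[OF X]
  have IC: "I \<subseteq> continuous_self_maps X"
    unfolding I_def by (rule isometric_self_maps_subset_continuous[OF X])
  have IP: "I \<subseteq> topspace (pointwise_topology X)"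
    by (auto simp: I_def isometric_self_maps_def)
  have T: "topspace ?T = I"
    using IP by (simp add: Int_absorb1)
  have CO: "topspace (subtopology ?CO I) = I"
    using IC by (simp add: Int_absorb1)
  have "continuous_map ?T ?CO (\<lambda>f. f)"
    unfolding compact_open_topology_def
  proof (rule continuous_on_generated_topo)
    fix V assume "V \<in> {{f \<in> continuous_self_maps X. f ` K \<subseteq> U} | K U. compactin X K \<and> openin X U}"
    then obtain K U where V: "V = {f \<in> continuous_self_maps X. f ` K \<subseteq> U}"
      and K: "compactin X K" and U: "openin X U"
      by blast
    have KS: "K \<subseteq> ?S"
      by (rule compactin_subset_topspace[OF K])
    have "\<exists>W. openin ?T W \<and> f \<in> W \<and> W \<subseteq> V \<inter> I" if "f \<in> V \<inter> I" for f
    proof -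
      have f: "f \<in> I" "f ` K \<subseteq> U"
        using that by (auto simp: V)
      note fI = isometric_self_mapsD[OF f(1)[unfolded I_def]]
      have "\<exists>r>0. mball (f x) (2 * r) \<subseteq> U" if "x \<in> K" for x
      proof -
        have "f x \<in> U" using f that by blast
        then obtain s where "s > 0" "mball (f x) s \<subseteq> U"
          using U openin_mtopology[of U] by auto
        then show ?thesis
          by (intro exI[of _ "s / 2"]) simp
      qed
      then obtain r where r: "\<And>x. x \<in> K \<Longrightarrow> r x > 0" "\<And>x. x \<in> K \<Longrightarrow> mball (f x) (2 * r x) \<subseteq> U"
        by metis
      have cover: "K \<subseteq> \<Union>((\<lambda>x. mball x (r x)) ` K)"
        using KS r(1) by auto
      have open_ball: "openin X (mball x (r x))" for x
        using openin_mball[of x "r x"] by simp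
      obtain F where F: "finite F" "F \<subseteq> K" "K \<subseteq> \<Union>((\<lambda>x. mball x (r x)) ` F)"
        by (rule compactin_finite_subfamily[OF K open_ball cover])
      define W where "W = I \<inter> (\<Inter>x\<in>F. {g \<in> topspace ?T. g x \<in> mball (f x) (r x)})"
      have "openin ?T {g \<in> topspace ?T. g x \<in> mball (f x) (r x)}" if "x \<in> F" for x
      proof (rule openin_continuous_map_preimage)
        show "continuous_map ?T X (\<lambda>g. g x)"
          using that F(2) KS
          by (intro continuous_map_from_subtopology continuous_map_evaluation_pointwise) auto
        show "openin X (mball (f x) (r x))"
          using openin_mball[of "f x" "r x"] by simp
      qed
      then have "openin ?T W"
        unfolding W_def using F(1) openin_topspace[of ?T] unfolding T
        by (cases "F = {}") (auto intro!: openin_Int openin_INT2)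
      moreover have "f \<in> W"
        unfolding W_def T using f(1) fI(1) F(2) KS r(1) by (auto simp: subset_iff)
      moreover have "g ` K \<subseteq> U" if g: "g \<in> W" for g
      proof
        fix z assume "z \<in> g ` K"
        then obtain x where x: "x \<in> K" "z = g x"
          by blast
        then obtain c where c: "c \<in> F" "x \<in> mball c (r c)"
          using F(3) by blast
        have gI: "g \<in> isometric_self_maps X d" and gc: "g c \<in> mball (f c) (r c)"
          using g c(1) by (auto simp: W_def I_def)
        note gI = isometric_self_mapsD[OF gI]
        have S: "c \<in> ?S" "x \<in> ?S" "f c \<in> ?S" "g c \<in> ?S" "g x \<in> ?S"
          using c x(1) KS F(2) fI(1) gI(1) by auto
        have "d (f c) (g x) < 2 * r c"
          using triangle[OF S(3-5)] gI(2)[OF S(1,2)] gc c(2) by simp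
        then have "g x \<in> mball (f c) (2 * r c)"
          using S by simp
        then show "z \<in> U"
          using r(2) c(1) F(2) x(2) by blast
      qed
      then have "W \<subseteq> V \<inter> I"
        using IC by (auto simp: W_def V)
      ultimately show ?thesis
        by blast
    qed
    then have "openin ?T (V \<inter> I)"
      by (subst openin_subopen) blast
    then show "openin ?T ((\<lambda>f. f) -` V \<inter> topspace ?T)"
      unfolding T by simp
  next
    show "(\<lambda>f. f) ` topspace ?T \<subseteq> \<Union> {{f \<in> continuous_self_maps X. f ` K \<subseteq> U} | K U. compactin X K \<and> openin X U}"
      using IC topspace_compact_open_topology[of X]
      unfolding T compact_open_topology_def topology_generated_by_topspace by simp
  qed
  then have "continuous_map ?T (subtopology ?CO I) (\<lambda>f. f)"
    by (simp add: continuous_map_in_subtopology T)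
  moreover have "continuous_map (subtopology ?CO I) ?T (\<lambda>f. f)"
    using continuous_map_from_subtopology[OF continuous_map_compact_open_pointwise, of X I] CO
    by (simp add: continuous_map_in_subtopology)
  moreover have "openin A U"
    if "continuous_map A B (\<lambda>f. f)" "topspace A = I" "topspace B = I" "openin B U" for A B U
  proof -
    have "{f \<in> topspace A. f \<in> U} = U"
      using openin_subset[OF that(4)] that(2,3) by auto
    then show ?thesis
      using openin_continuous_map_preimage[OF that(1,4)] by simp
  qed
  ultimately show ?thesis
    using CO T unfolding topology_eq by metis
qed

lemma compose_isometric_self_maps:
  assumes "f \<in> isometric_self_maps X d" "g \<in> isometric_self_maps X d"
  shows "compose (topspace X) f g \<in> isometric_self_maps X d"
  using isometric_self_mapsD[OF assms(1)] isometric_self_mapsD[OF assms(2)]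
  by (auto simp: isometric_self_maps_def compose_eq compose_def)

text \<open>For \<open>f'\<close> near \<open>f\<close> and \<open>g'\<close> near \<open>g\<close>, the distance from \<open>f (g x)\<close> to \<open>f' (g' x)\<close> splits into that
  from \<open>f (g x)\<close> to \<open>f' (g x)\<close> and, as \<open>f'\<close> preserves distances, that from \<open>g x\<close> to \<open>g' x\<close>. The
  first is controlled at the single point \<open>g x\<close>, the second at \<open>x\<close>.\<close>

lemma continuous_map_compose_isometries:
  assumes X: "metric_for X d"
  defines "T \<equiv> subtopology (pointwise_topology X) (isometric_self_maps X d)"
  shows "continuous_map (prod_topology T T) T (\<lambda>(f, g). compose (topspace X) f g)"
proof -
  let ?S = "topspace X"
  interpret Metric_space ?S d by (rule metric_forD[OF X])
  have T: "topspace T = isometric_self_maps X d"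
    unfolding T_def by (auto simp: isometric_self_maps_def)
  have ev: "continuous_map T X (\<lambda>f. f y)" if "y \<in> ?S" for y
    unfolding T_def
    by (intro continuous_map_from_subtopology continuous_map_evaluation_pointwise that)
  have ball: "openin X (mball y r)" for y r
    using openin_mball[of y r] metric_forD(2)[OF X] by simp
  have "continuous_map (prod_topology T T) X (\<lambda>p. compose ?S (fst p) (snd p) x)" if x: "x \<in> ?S" for x
    unfolding continuous_map_into_metric[OF X] topspace_prod_topology T
  proof (intro ballI allI impI)
    fix p \<epsilon> assume p: "p \<in> isometric_self_maps X d \<times> isometric_self_maps X d" and \<epsilon>: "(0::real) < \<epsilon>"
    obtain f g where p_eq: "p = (f, g)" by force
    have fg: "f \<in> isometric_self_maps X d" "g \<in> isometric_self_maps X d"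
      using p by (simp_all add: p_eq)
    note fI = isometric_self_mapsD[OF fg(1)] and gI = isometric_self_mapsD[OF fg(2)]
    define V where "V = {f' \<in> topspace T. f' (g x) \<in> mball (f (g x)) (\<epsilon> / 2)}"
    define W where "W = {g' \<in> topspace T. g' x \<in> mball (g x) (\<epsilon> / 2)}"
    have "openin T V" "openin T W"
      unfolding V_def W_def
      by (intro openin_continuous_map_preimage[OF ev] ball x gI(1))+
    moreover have "p \<in> V \<times> W"
      using fg fI(1) gI(1) x \<epsilon> by (simp add: p_eq V_def W_def T)
    moreover have "compose ?S (fst q) (snd q) x \<in> mball (compose ?S (fst p) (snd p) x) \<epsilon>"
      if q: "q \<in> V \<times> W" for q
    proof -
      obtain f' g' where q_eq: "q = (f', g')" by force
      have fg': "f' \<in> isometric_self_maps X d" "g' \<in> isometric_self_maps X d"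
        and close: "d (f (g x)) (f' (g x)) < \<epsilon> / 2" "d (g x) (g' x) < \<epsilon> / 2"
        using q by (auto simp: q_eq V_def W_def T)
      note fI' = isometric_self_mapsD[OF fg'(1)] and gI' = isometric_self_mapsD[OF fg'(2)]
      have "d (f (g x)) (f' (g' x)) \<le> d (f (g x)) (f' (g x)) + d (f' (g x)) (f' (g' x))"
        by (rule triangle) (intro fI fI' gI gI' x)+
      then show ?thesis
        using close fI'(2)[OF gI(1)[OF x] gI'(1)[OF x]] x
        by (simp add: p_eq q_eq compose_eq fI gI fI' gI')
    qed
    ultimately show "\<exists>U. openin (prod_topology T T) U \<and> p \<in> U \<and>
        (\<forall>q\<in>U. compose ?S (fst q) (snd q) x \<in> mball (compose ?S (fst p) (snd p) x) \<epsilon>)"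
      by (intro exI[of _ "V \<times> W"]) (simp add: openin_prod_Times_iff)
  qed
  then have "continuous_map (prod_topology T T) (pointwise_topology X) (\<lambda>p. compose ?S (fst p) (snd p))"
    by (intro continuous_map_coordinatewise_then_product) (auto simp: compose_def)
  then show ?thesis
    unfolding T_def[THEN meta_eq_to_obj_eq] case_prod_beta
    by (subst continuous_map_in_subtopology)
      (auto simp: T[unfolded T_def] T_def[symmetric] T compose_isometric_self_maps)
qed

section \<open>Closures of groups of isometries\<close>

lemma Hausdorff_space_pointwise:
  assumes "metric_for X d"
  shows "Hausdorff_space (subtopology (pointwise_topology X) I)"
  using Hausdorff_space_metric_for[OF assms]
  by (simp add: Hausdorff_space_product_topology Hausdorff_space_subtopology)

text \<open>The closure in the compact-open topology may thus be computed pointwise, inside the set of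
  distance-preserving maps, which is closed in both topologies.\<close>

lemma isometric_closure_compact_open:
  assumes X: "metric_for X d" and G: "G \<subseteq> isometric_self_maps X d"
  defines "T \<equiv> subtopology (pointwise_topology X) (isometric_self_maps X d)"
  shows "compact_open_topology X closure_of G = T closure_of G"
proof -
  let ?CO = "compact_open_topology X"
  let ?I = "isometric_self_maps X d"
  have "closedin ?CO {f \<in> topspace ?CO. f \<in> ?I}"
    by (rule closedin_continuous_map_preimage[OF continuous_map_compact_open_pointwise
          closedin_isometric_self_maps[OF X]])
  moreover have "{f \<in> topspace ?CO. f \<in> ?I} = ?I"
    using isometric_self_maps_subset_continuous[OF X] by auto
  ultimately have "?CO closure_of G \<subseteq> ?I"
    using closure_of_minimal[OF G] by simp
  then have "?CO closure_of G = subtopology ?CO ?I closure_of G"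
    using G by (simp add: closure_of_subtopology Int_absorb1 Int_absorb2)
  then show ?thesis
    using compact_open_eq_pointwise_on_isometries[OF X] by (simp add: T_def)
qed

text \<open>By Tychonoff's theorem: the pointwise closure is a closed subset of the product of the compact
  orbit closures.\<close>

lemma compactin_pointwise_closure:
  assumes X: "metric_for X d" and G: "G \<subseteq> isometric_self_maps X d"
    and orbits: "\<forall>x\<in>topspace X. compactin X (X closure_of ((\<lambda>f. f x) ` G))"
  defines "T \<equiv> subtopology (pointwise_topology X) (isometric_self_maps X d)"
  shows "compactin T (T closure_of G)"
proof -
  let ?S = "topspace X"
  let ?P = "pointwise_topology X"
  let ?I = "isometric_self_maps X d"
  define Q where "Q = (\<Pi>\<^sub>E x\<in>?S. X closure_of ((\<lambda>f. f x) ` G))"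
  have "Hausdorff_space ?P"
    using Hausdorff_space_pointwise[OF X, of UNIV] by simp
  moreover have Q: "compactin ?P Q"
    using orbits by (simp add: Q_def compactin_PiE)
  ultimately have "closedin ?P Q"
    by (rule compactin_imp_closedin)
  moreover have "G \<subseteq> Q"
  proof
    fix f assume f: "f \<in> G"
    have "f x \<in> X closure_of ((\<lambda>f. f x) ` G)" if x: "x \<in> ?S" for x
    proof -
      have "(\<lambda>f. f x) ` G \<subseteq> ?S"
        using isometric_self_mapsD(1)[OF subsetD[OF G]] x by blast
      then show ?thesis
        using closure_of_subset f by blast
    qed
    moreover have "f \<in> extensional ?S"
      using isometric_self_mapsD(3) G f by blast
    ultimately show "f \<in> Q"
      by (simp add: Q_def PiE_iff)
  qed
  ultimately have "?P closure_of G \<subseteq> Q"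
    by (simp add: closure_of_minimal)
  moreover have cl: "T closure_of G = ?I \<inter> ?P closure_of G"
    using G by (simp add: T_def closure_of_subtopology Int_absorb1)
  ultimately have "compactin ?P (T closure_of G)"
    using closed_compactin[OF Q, of "T closure_of G"] closedin_isometric_self_maps[OF X]
    by (simp add: closedin_Int le_infI2)
  then show ?thesis
    by (simp add: T_def cl[unfolded T_def] compactin_subtopology)
qed

lemma isometric_closure_subset:
  assumes "metric_for X d" "G \<subseteq> isometric_self_maps X d"
  shows "compact_open_topology X closure_of G \<subseteq> isometric_self_maps X d"
  using isometric_closure_compact_open[OF assms] by (simp add: closure_of_subtopology)

lemma isometric_closure_compact:
  assumes X: "metric_for X d" and G: "G \<subseteq> isometric_self_maps X d"
    and orbits: "\<forall>x\<in>topspace X. compactin X (X closure_of ((\<lambda>f. f x) ` G))"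
  shows "compactin (compact_open_topology X) (compact_open_topology X closure_of G)"
  using compactin_pointwise_closure[OF assms] isometric_closure_compact_open[OF X G]
    compact_open_eq_pointwise_on_isometries[OF X]
  by (metis compactin_subtopology)

lemma closure_closed_under_compose:
  assumes X: "metric_for X d"
  defines "T \<equiv> subtopology (pointwise_topology X) (isometric_self_maps X d)"
  assumes G: "\<And>f g. f \<in> G \<Longrightarrow> g \<in> G \<Longrightarrow> compose (topspace X) f g \<in> G"
    and fg: "f \<in> T closure_of G" "g \<in> T closure_of G"
  shows "compose (topspace X) f g \<in> T closure_of G"
proof -
  let ?m = "\<lambda>(f, g). compose (topspace X) f g"
  have "?m ` (prod_topology T T closure_of (G \<times> G)) \<subseteq> T closure_of (?m ` (G \<times> G))"
    using continuous_map_compose_isometries[OF X] unfolding T_def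
    by (rule continuous_map_image_closure_subset)
  also have "\<dots> \<subseteq> T closure_of G"
    using G by (intro closure_of_mono) auto
  finally show ?thesis
    using fg by (force simp: closure_of_Times)
qed

lemma closure_commutative:
  assumes X: "metric_for X d"
  defines "T \<equiv> subtopology (pointwise_topology X) (isometric_self_maps X d)"
  assumes G: "\<And>f g. f \<in> G \<Longrightarrow> g \<in> G \<Longrightarrow> compose (topspace X) f g = compose (topspace X) g f"
    and fg: "f \<in> T closure_of G" "g \<in> T closure_of G"
  shows "compose (topspace X) f g = compose (topspace X) g f"
proof -
  let ?m = "\<lambda>(f, g). compose (topspace X) f g"
  have m: "continuous_map (prod_topology T T) T ?m"
    unfolding T_def by (rule continuous_map_compose_isometries[OF X])
  have "continuous_map (prod_topology T T) (prod_topology T T) (\<lambda>p. (snd p, fst p))"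
    by (intro continuous_map_pairedI continuous_map_fst continuous_map_snd)
  then have m': "continuous_map (prod_topology T T) T (?m \<circ> (\<lambda>p. (snd p, fst p)))"
    using m by (rule continuous_map_compose)
  have "?m (f, g) = (?m \<circ> (\<lambda>p. (snd p, fst p))) (f, g)"
  proof (rule forall_in_closure_of_eq[OF _ _ m m'])
    show "(f, g) \<in> prod_topology T T closure_of (G \<times> G)"
      using fg by (simp add: closure_of_Times)
    show "Hausdorff_space T"
      unfolding T_def by (rule Hausdorff_space_pointwise[OF X])
  qed (use G in auto)
  then show ?thesis
    by simp
qed

text \<open>The pairs \<open>(f, g)\<close> in the compact square of the closure with \<open>f \<circ> g = id\<close> form a compact set,
  so the first coordinates of these pairs form a closed set. It contains the group, hence its closure.
  This yields surjectivity of the limits, which fails for limits of isometries in general.\<close>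

lemma closure_has_inverses:
  assumes X: "metric_for X d"
  defines "T \<equiv> subtopology (pointwise_topology X) (isometric_self_maps X d)"
  assumes GI: "G \<subseteq> isometric_self_maps X d"
    and compact: "compactin T (T closure_of G)"
    and one: "restrict id (topspace X) \<in> G"
    and inv: "\<And>f. f \<in> G \<Longrightarrow> \<exists>g\<in>G. compose (topspace X) f g = restrict id (topspace X)"
    and f: "f \<in> T closure_of G"
  shows "\<exists>g \<in> T closure_of G. compose (topspace X) f g = restrict id (topspace X)"
proof -
  let ?e = "restrict id (topspace X)"
  let ?m = "\<lambda>(f, g). compose (topspace X) f g"
  let ?K = "T closure_of G"
  have T: "topspace T = isometric_self_maps X d"
    unfolding T_def by (auto simp: isometric_self_maps_def)
  have haus: "Hausdorff_space T"
    unfolding T_def by (rule Hausdorff_space_pointwise[OF X])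
  have GK: "G \<subseteq> ?K"
    using GI by (intro closure_of_subset) (simp add: T)
  define L where "L = {p \<in> topspace (prod_topology T T). ?m p \<in> {?e}}"
  have "closedin (prod_topology T T) L"
    unfolding L_def
  proof (rule closedin_continuous_map_preimage)
    show "continuous_map (prod_topology T T) T ?m"
      unfolding T_def by (rule continuous_map_compose_isometries[OF X])
    show "closedin T {?e}"
      using one GI haus by (intro compactin_imp_closedin) (auto simp: T)
  qed
  then have "compactin (prod_topology T T) (?K \<times> ?K \<inter> L)"
    using compact by (intro compact_Int_closedin) (simp_all add: compactin_Times)
  then have "compactin T (fst ` (?K \<times> ?K \<inter> L))"
    by (rule image_compactin[OF _ continuous_map_fst])
  then have "closedin T (fst ` (?K \<times> ?K \<inter> L))"
    by (rule compactin_imp_closedin[OF haus])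
  moreover have "G \<subseteq> fst ` (?K \<times> ?K \<inter> L)"
  proof
    fix f assume f: "f \<in> G"
    then obtain g where g: "g \<in> G" "compose (topspace X) f g = ?e"
      using inv by blast
    have "(f, g) \<in> ?K \<times> ?K \<inter> L"
      using f g GK GI by (auto simp: L_def T)
    then show "f \<in> fst ` (?K \<times> ?K \<inter> L)"
      by force
  qed
  ultimately have "?K \<subseteq> fst ` (?K \<times> ?K \<inter> L)"
    by (simp add: closure_of_minimal)
  then show ?thesis
    using f by (fastforce simp: L_def)
qed

text \<open>As \<open>g\<close> preserves distances, \<open>f\<inverse> x\<close> and \<open>g\<inverse> x\<close> are as far apart as \<open>g (f\<inverse> x)\<close> and
  \<open>x = f (f\<inverse> x)\<close>, which is controlled by evaluation at the single point \<open>f\<inverse> x\<close>.\<close>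

lemma continuous_map_isometry_inverse:
  assumes X: "metric_for X d" and K: "K \<subseteq> isometric_self_maps X d"
    and i: "\<And>f. f \<in> K \<Longrightarrow> i f \<in> K"
    and inv: "\<And>f x. f \<in> K \<Longrightarrow> x \<in> topspace X \<Longrightarrow> f (i f x) = x"
  shows "continuous_map (subtopology (pointwise_topology X) K) (subtopology (pointwise_topology X) K) i"
proof -
  let ?S = "topspace X"
  let ?T = "subtopology (pointwise_topology X) K"
  interpret Metric_space ?S d by (rule metric_forD[OF X])
  have T: "topspace ?T = K"
    using K by (auto simp: isometric_self_maps_def)
  have KI: "f x \<in> ?S" if "f \<in> K" "x \<in> ?S" for f x
    using isometric_self_mapsD(1)[OF subsetD[OF K that(1)] that(2)] .
  have "continuous_map ?T X (\<lambda>f. i f x)" if x: "x \<in> ?S" for x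
    unfolding continuous_map_into_metric[OF X] T
  proof (intro ballI allI impI)
    fix f \<epsilon> assume f: "f \<in> K" and \<epsilon>: "(0::real) < \<epsilon>"
    define U where "U = {g \<in> topspace ?T. g (i f x) \<in> mball x \<epsilon>}"
    have "openin ?T U"
      unfolding U_def
    proof (rule openin_continuous_map_preimage)
      show "continuous_map ?T X (\<lambda>g. g (i f x))"
        using KI[OF i[OF f] x]
        by (intro continuous_map_from_subtopology continuous_map_evaluation_pointwise)
      show "openin X (mball x \<epsilon>)"
        using openin_mball[of x \<epsilon>] metric_forD(2)[OF X] by simp
    qed
    moreover have "f \<in> U"
      unfolding U_def T using f x \<epsilon> inv[OF f x] by simp
    moreover have "i g x \<in> mball (i f x) \<epsilon>" if g: "g \<in> U" for g
    proof -
      have gK: "g \<in> K" and close: "d x (g (i f x)) < \<epsilon>"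
        using g by (auto simp: U_def T)
      have "d (i f x) (i g x) = d (g (i f x)) (g (i g x))"
        using isometric_self_mapsD(2)[OF subsetD[OF K gK]] KI i f gK x by simp
      also have "\<dots> = d x (g (i f x))"
        using inv[OF gK x] commute by simp
      finally show ?thesis
        using close KI i f gK x by simp
    qed
    ultimately show "\<exists>U. openin ?T U \<and> f \<in> U \<and> (\<forall>g\<in>U. i g x \<in> mball (i f x) \<epsilon>)"
      by blast
  qed
  moreover have "i f x = undefined" if "x \<notin> ?S" "f \<in> K" for f x
    using isometric_self_mapsD(3)[OF subsetD[OF K i[OF that(2)]]] that(1)
    by (simp add: extensional_def)
  ultimately have "continuous_map ?T (pointwise_topology X) i"
    using T by (intro continuous_map_coordinatewise_then_product) auto
  then show ?thesis
    using i T by (auto simp: continuous_map_in_subtopology)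
qed

lemma isometry_if_right_inverse:
  assumes X: "metric_for X d" and f: "f \<in> isometric_self_maps X d"
    and g: "g \<in> isometric_self_maps X d"
    and inv: "compose (topspace X) f g = restrict id (topspace X)"
  shows "isometry (topspace X) d f"
proof -
  let ?S = "topspace X"
  interpret Metric_space ?S d by (rule metric_forD[OF X])
  note fI = isometric_self_mapsD[OF f] and gI = isometric_self_mapsD[OF g]
  have fg: "f (g x) = x" if "x \<in> ?S" for x
    using fun_cong[OF inv, of x] that by (simp add: compose_eq)
  moreover have "g (f x) = x" if x: "x \<in> ?S" for x
    using fI(2)[of "g (f x)" x] fg[OF fI(1)[OF x]] fI(1) gI(1) x by simp
  moreover have "continuous_map X X f" "continuous_map X X g"
    using isometric_self_maps_subset_continuous[OF X] f g by (auto simp: continuous_self_maps_def)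
  ultimately have "homeomorphic_maps X X f g"
    by (simp add: homeomorphic_maps_def)
  then show ?thesis
    using fI(2) metric_forD(2)[OF X] homeomorphic_maps_imp_map by (auto simp: isometry_def)
qed

lemma composition_monoid_simps [simp]:
  "carrier (composition_monoid S F) = F"
  "f \<otimes>\<^bsub>composition_monoid S F\<^esub> g = compose S f g"
  "\<one>\<^bsub>composition_monoid S F\<^esub> = restrict id S"
  by (simp_all add: composition_monoid_def)

text \<open>Closure under composition and commutativity pass from \<open>G\<close> to its closure by continuity of
  composition, inverses by compactness.\<close>

lemma isometric_closure_topological_group:
  assumes X: "metric_for X d" and GI: "G \<subseteq> isometric_self_maps X d"
    and one: "restrict id (topspace X) \<in> G"
    and comp: "\<And>f g. f \<in> G \<Longrightarrow> g \<in> G \<Longrightarrow> compose (topspace X) f g \<in> G"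
    and comm: "\<And>f g. f \<in> G \<Longrightarrow> g \<in> G \<Longrightarrow> compose (topspace X) f g = compose (topspace X) g f"
    and inv: "\<And>f. f \<in> G \<Longrightarrow> \<exists>g\<in>G. compose (topspace X) f g = restrict id (topspace X)"
    and orbits: "\<forall>x\<in>topspace X. compactin X (X closure_of ((\<lambda>f. f x) ` G))"
  defines "K \<equiv> compact_open_topology X closure_of G"
  shows "comm_group (composition_monoid (topspace X) K)" (is "comm_group ?M")
    and "topological_group (composition_monoid (topspace X) K)
           (subtopology (compact_open_topology X) K)"
    and "\<forall>f\<in>K. isometry (topspace X) d f"
proof -
  let ?S = "topspace X"
  let ?I = "isometric_self_maps X d"
  define T where "T = subtopology (pointwise_topology X) ?I"
  have K: "K = T closure_of G"
    unfolding K_def T_def by (rule isometric_closure_compact_open[OF X GI])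
  have KI: "K \<subseteq> ?I"
    unfolding K_def by (rule isometric_closure_subset[OF X GI])
  have T: "topspace T = ?I"
    unfolding T_def by (auto simp: isometric_self_maps_def)
  have compact: "compactin T K"
    unfolding K T_def by (rule compactin_pointwise_closure[OF X GI orbits])
  have GK: "G \<subseteq> K"
    unfolding K using GI by (intro closure_of_subset) (simp add: T)
  have compK: "compose ?S f g \<in> K" if "f \<in> K" "g \<in> K" for f g
    using that unfolding K T_def by (intro closure_closed_under_compose[OF X] comp)
  have commK: "compose ?S f g = compose ?S g f" if "f \<in> K" "g \<in> K" for f g
    by (rule closure_commutative[OF X, of G]) (use comm that in \<open>auto simp: K T_def\<close>)
  have invK: "\<exists>g\<in>K. compose ?S f g = restrict id ?S" if "f \<in> K" for f
    using compact that unfolding K T_def by (intro closure_has_inverses[OF X GI _ one] inv)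
  have maps: "f \<in> ?S \<rightarrow> ?S" "f \<in> extensional ?S" if "f \<in> K" for f
    using isometric_self_mapsD(1,3)[OF subsetD[OF KI that]] by auto
  show "\<forall>f\<in>K. isometry ?S d f"
    using invK KI isometry_if_right_inverse[OF X] by (meson subsetD)
  show group: "comm_group ?M"
  proof (rule comm_groupI; unfold composition_monoid_simps)
    show "restrict id ?S \<in> K"
      using one GK by blast
    fix f g h assume f: "f \<in> K" and "g \<in> K" and "h \<in> K"
    then show "compose ?S (compose ?S f g) h = compose ?S f (compose ?S g h)"
      using maps by (simp add: compose_assoc[of h ?S ?S])
    show "compose ?S (restrict id ?S) f = f"
      using Id_compose[OF maps[OF f]] by (simp add: id_def)
    show "\<exists>g\<in>K. compose ?S g f = restrict id ?S"
      using invK[OF f] commK[OF f] by metis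
  qed (use compK commK in auto)
  interpret M: comm_group ?M by (rule group)
  have top: "subtopology (compact_open_topology X) K = subtopology T K"
    using compact_open_eq_pointwise_on_isometries[OF X] KI
    by (metis T_def inf.absorb_iff2 subtopology_subtopology)
  have top': "subtopology T K = subtopology (pointwise_topology X) K"
    using KI by (simp add: T_def subtopology_subtopology Int_absorb1)
  have topspace_K: "topspace (subtopology T K) = K"
    using KI by (simp add: T Int_absorb1)
  have "continuous_map (subtopology (prod_topology T T) (K \<times> K)) T (\<lambda>(f, g). compose ?S f g)"
    using continuous_map_compose_isometries[OF X] unfolding T_def
    by (rule continuous_map_from_subtopology)
  then have "continuous_map (prod_topology (subtopology T K) (subtopology T K)) (subtopology T K)
      (\<lambda>(f, g). compose ?S f g)"
    unfolding subtopology_Times[symmetric] using compK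
    by (auto simp: continuous_map_in_subtopology)
  moreover have "continuous_map (subtopology T K) (subtopology T K) (\<lambda>f. inv\<^bsub>?M\<^esub> f)"
    unfolding top'
  proof (rule continuous_map_isometry_inverse[OF X KI])
    show closed: "inv\<^bsub>?M\<^esub> f \<in> K" if "f \<in> K" for f
      using M.inv_closed[of f] that by simp
    show "f ((inv\<^bsub>?M\<^esub> f) x) = x" if "f \<in> K" "x \<in> ?S" for f x
      using fun_cong[OF M.r_inv[of f], of x] that by (simp add: compose_eq)
  qed
  ultimately show "topological_group ?M (subtopology (compact_open_topology X) K)"
    using M.is_group topspace_K by (simp add: topological_group_def top)
qed

section \<open>The equivalence\<close>

lemma iterates_subset_isometric_self_maps:
  assumes h: "bij_betw h (topspace X) (topspace X)"
    and iso: "\<forall>x\<in>topspace X. \<forall>y\<in>topspace X. d x y = d (h x) (h y)"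
  shows "range (iterate (topspace X) h) \<subseteq> isometric_self_maps X d"
  using iterate_step(1)[OF h] iterate_extensional distance_iterate[where d = d, OF h iso]
  by (auto simp: isometric_self_maps_def PiE_iff)

lemma isometric_closure_iterates:
  assumes X: "metric_for X d" and hom: "homeomorphic_map X X h"
    and iso: "\<forall>x\<in>topspace X. \<forall>y\<in>topspace X. d x y = d (h x) (h y)"
    and orbits: "\<forall>x\<in>topspace X.
           compactin X (X closure_of (range (\<lambda>n. iterate (topspace X) h n x)))"
  defines "H \<equiv> compact_open_topology X closure_of range (iterate (topspace X) h)"
  shows "compactin (compact_open_topology X) H \<and>
         comm_group (composition_monoid (topspace X) H) \<and>
         topological_group (composition_monoid (topspace X) H)
           (subtopology (compact_open_topology X) H) \<and>
         (\<forall>f\<in>H. isometry (topspace X) d f)"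
proof -
  let ?S = "topspace X"
  let ?G = "range (iterate ?S h)"
  note h = bij_betw_homeomorphic_map[OF hom]
  note comp = compose_iterate[OF h]
  have G: "?G \<subseteq> isometric_self_maps X d"
    by (rule iterates_subset_isometric_self_maps[OF h iso])
  have orbits': "\<forall>x\<in>?S. compactin X (X closure_of ((\<lambda>f. f x) ` ?G))"
    using orbits by (simp add: image_image)
  have one: "restrict id ?S \<in> ?G"
    by (metis iterate_0 rangeI)
  have mult: "compose ?S f g \<in> ?G" and comm: "compose ?S f g = compose ?S g f"
    if "f \<in> ?G" "g \<in> ?G" for f g
    using that by (auto simp: comp add.commute)
  have inv: "\<exists>g\<in>?G. compose ?S f g = restrict id ?S" if f: "f \<in> ?G" for f
  proof -
    obtain n where "f = iterate ?S h n"
      using f by blast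
    then have "compose ?S f (iterate ?S h (- n)) = restrict id ?S"
      by (simp add: comp iterate_0)
    then show ?thesis
      by blast
  qed
  show ?thesis
    unfolding H_def
    using isometric_closure_compact[OF X G orbits']
      isometric_closure_topological_group[OF X G one mult comm inv orbits']
    by blast
qed

lemma all_equivalent_two_cycles:
  assumes "P1 \<Longrightarrow> P4" "P4 \<Longrightarrow> P2" "P2 \<Longrightarrow> P3" "P3 \<Longrightarrow> P1"
    and "P3 \<Longrightarrow> P6" "P6 \<Longrightarrow> P5" "P5 \<Longrightarrow> P4"
  shows "all_equivalent [P1, P2, P3, P4, P5, P6]"
  unfolding all_equivalent_def using assms by auto

theorem theorem2:
  fixes X :: "'a topology" and h :: "'a \<Rightarrow> 'a"
  defines "iterates \<equiv> range (iterate (topspace X) h)"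
  defines "H \<equiv> compact_open_topology X closure_of iterates"
  assumes "metrizable_space X"
    and "homeomorphic_map X X h"
    and "\<And>x. x \<in> topspace X \<Longrightarrow>
           compactin X (X closure_of (range (\<lambda>n::int. iterate (topspace X) h n x)))"
  shows "all_equivalent
    [compactly_almost_periodic X h,
     \<exists>d. metric_for X d \<and> equicontinuous (topspace X) d (topspace X) d iterates,
     \<exists>d. metric_for X d \<and> isometry (topspace X) d h,
     \<forall>d. metric_for X d \<longrightarrow> equicontinuous (topspace X) d (topspace X) d iterates,
     compactin (compact_open_topology X) H,
     \<exists>d. metric_for X d \<and>
         compactin (compact_open_topology X) H \<and>
         comm_group (composition_monoid (topspace X) H) \<and>
         topological_group (composition_monoid (topspace X) H)
           (subtopology (compact_open_topology X) H) \<and>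
         (\<forall>f\<in>H. isometry (topspace X) d f)]"
    (is "all_equivalent [?cap, ?equi, ?iso, ?equi_all, ?compact, ?group]")
proof -
  let ?S = "topspace X"
  have hom: "homeomorphic_map X X h"
    by fact
  note h = bij_betw_homeomorphic_map[OF hom]
  have orbits: "\<forall>x\<in>?S. compactin X (X closure_of (range (\<lambda>n. iterate ?S h n x)))"
    using assms(5) by blast
  obtain d\<^sub>0 where d\<^sub>0: "metric_for X d\<^sub>0"
    using assms(3) unfolding metrizable_space_def metric_for_def
    by (metis Metric_space.topspace_mtopology)
  have cap_equi_all: ?equi_all if ?cap
    unfolding iterates_def using equicontinuous_iterates_if_compactly_almost_periodic that by blast
  have equi_all_equi: ?equi if ?equi_all
    using that d\<^sub>0 by blast
  have equi_iso: ?iso if ?equi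
  proof -
    from that obtain d where d: "metric_for X d" "equicontinuous ?S d ?S d (range (iterate ?S h))"
      unfolding iterates_def by blast
    from invariant_metric_if_equicontinuous[OF d(1) h d(2)] obtain d' where d': "metric_for X d'"
      "\<forall>x\<in>?S. \<forall>y\<in>?S. d' x y = d' (h x) (h y)" .
    then have "isometry ?S d' h"
      using hom metric_forD(2)[OF d'(1)] unfolding isometry_def by metis
    then show ?thesis
      using d'(1) by blast
  qed
  have iso_cap: ?cap if ?iso
  proof -
    from that obtain d where d: "metric_for X d" "\<forall>x\<in>?S. \<forall>y\<in>?S. d x y = d (h x) (h y)"
      unfolding isometry_def by blast
    show ?thesis
      by (rule compactly_almost_periodic_if_isometry[OF d(1) hom d(2) orbits])
  qed
  have iso_group: ?group if ?iso
  proof -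
    from that obtain d where d: "metric_for X d" "\<forall>x\<in>?S. \<forall>y\<in>?S. d x y = d (h x) (h y)"
      unfolding isometry_def by blast
    show ?thesis
      using d(1) isometric_closure_iterates[OF d(1) hom d(2) orbits]
      unfolding H_def iterates_def by blast
  qed
  have group_compact: ?compact if ?group
    using that by blast
  have compact_equi_all: ?equi_all if ?compact
  proof (intro allI impI)
    fix d assume d: "metric_for X d"
    have "iterates \<subseteq> continuous_self_maps X"
      using homeomorphic_imp_continuous_map[OF homeomorphic_map_iterate[OF hom]] iterate_extensional
      by (auto simp: iterates_def continuous_self_maps_def)
    then have "iterates \<subseteq> H"
      unfolding H_def by (intro closure_of_subset) simp
    moreover have "equicontinuous ?S d ?S d H"
      by (rule equicontinuous_if_compact_open_compact[OF d that])
    ultimately show "equicontinuous ?S d ?S d iterates"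
      unfolding equicontinuous_def by (meson subset_iff)
  qed
  show ?thesis
    by (rule all_equivalent_two_cycles)
      (fact cap_equi_all equi_all_equi equi_iso iso_cap iso_group group_compact compact_equi_all)+
qed

end
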